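(* Let $V$ be a finite dimensional rational $G$-module with a decomposition $V\cong M\oplus N$ over $G_r$, and suppose that any (equivalently, all) of the following equivalent conditions hold: (1) every $G_r$-summand of $V$ isomorphic to $M$ is a $G_r$-complement to $N$; (2) every $G_r$-summand of $V$ isomorphic to $N$ is a $G_r$-complement to $M$; (3) every $G_r$-summand of $V$ isomorphic to $M$ is a $G_r$-complement to every $G_r$-summand of $V$ isomorphic to $N$; (4) $\mathrm{Aut}_{G_r}(V)\cong \mathrm{Aut}_{G_r}(M)\times\mathrm{Hom}_{G_r}(M,N)\times\mathrm{Hom}_{G_r}(N,M)\times\mathrm{Aut}_{G_r}(N)$ (via the block decomposition of $\mathrm{End}_{G_r}(V)$); (5) every $X\in\mathrm{Hom}_{G_r}(M,N)\oplus\mathrm{Hom}_{G_r}(N,M)$ is a nilpotent endomorphism of $V$. Then there are isomorphisms of varieties $$\mathfrak{X}^V_M\cong\mathrm{Hom}_{G_r}(M,N),\qquad \mathfrak{X}^V_N\cong\mathrm{Hom}_{G_r}(N,M).$$ Furthermore, the set of all $G_r$-decompositions of $V$ into modules isomorphic to $M$ and $N$ (that is, pairs $(M',N')$ of $G_r$-submodules with $V=M'\oplus N'$, $M'\cong M$, $N'\cong N$ over $G_r$) can be identified with the variety $\mathfrak{X}^V_M\times\mathfrak{X}^V_N$.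
   Context: $k$ is an algebraically closed field of characteristic $p>0$, $G$ is a simple simply connected algebraic group over $k$, and $G_r$ ($r\ge 1$) is its $r$-th Frobenius kernel. A $G_r$-summand of $V$ is a $G_r$-submodule having a $G_r$-stable complement in $V$. The modules $M,N$ are identified with $G_r$-submodules of $V$ such that $V=M\oplus N$. $\mathrm{End}_{G_r}(V)=\mathrm{End}_{G_r}(M)\oplus\mathrm{Hom}_{G_r}(M,N)\oplus\mathrm{Hom}_{G_r}(N,M)\oplus\mathrm{End}_{G_r}(N)$ is the block decomposition; the Hom spaces are regarded as affine spaces. For a $G_r$-summand $M$ of $V$ of dimension $m$, $\mathfrak{X}^V_M$ is the set of all $G_r$-summands of $V$ isomorphic to $M$ as $G_r$-modules. It is an orbit of $\mathrm{Aut}_{G_r}(V)\le GL(V)$ on the Grassmannian $\mathfrak{Grass}_m(V)$ of $m$-dimensional subspaces of $V$, and is given the structure of a (reduced, locally closed) subvariety of it; $G$ acts on it through its action on $V$. *)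

theory Defs
  imports
    "HOL-Analysis.Abstract_Topology"
    "HOL-Algebra.Coset"
    "HOL-Computational_Algebra.Computational_Algebra"
    "Jordan_Normal_Form.Determinant"
begin

section \<open>Varieties as spaces with functions\<close>

text \<open>A variety over the algebraically closed field of scalars is given by its set of points, its
  Zariski topology, and for every open set \<open>U\<close> the functions regular on \<open>U\<close>, which are taken
  to be extensional on \<open>U\<close>.\<close>

record ('a, 'k) fun_space =
  zariski :: "'a topology"
  regular :: "'a set \<Rightarrow> ('a \<Rightarrow> 'k) set"

abbreviation points :: "('a, 'k) fun_space \<Rightarrow> 'a set" where
  "points X \<equiv> topspace (zariski X)"

definition variety_morphism :: "('a, 'k) fun_space \<Rightarrow> ('b, 'k) fun_space \<Rightarrow> ('a \<Rightarrow> 'b) \<Rightarrow> bool" where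
  "variety_morphism X Y \<phi> \<longleftrightarrow>
     continuous_map (zariski X) (zariski Y) \<phi> \<and>
     (\<forall>U. openin (zariski Y) U \<longrightarrow>
        (\<forall>f \<in> regular Y U. restrict (f \<circ> \<phi>) {x \<in> points X. \<phi> x \<in> U}
                          \<in> regular X {x \<in> points X. \<phi> x \<in> U}))"

definition variety_isomorphic :: "('a, 'k) fun_space \<Rightarrow> ('b, 'k) fun_space \<Rightarrow> bool" where
  "variety_isomorphic X Y \<longleftrightarrow>
     (\<exists>\<phi> \<psi>. variety_morphism X Y \<phi> \<and> variety_morphism Y X \<psi> \<and>
        (\<forall>x \<in> points X. \<psi> (\<phi> x) = x) \<and> (\<forall>y \<in> points Y. \<phi> (\<psi> y) = y))"

definition subvariety :: "('a, 'k) fun_space \<Rightarrow> 'a set \<Rightarrow> ('a, 'k) fun_space" where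
  "subvariety Y X = \<lparr>
     zariski = subtopology (zariski Y) X,
     regular = (\<lambda>U. {h \<in> extensional U. \<forall>x \<in> U. \<exists>U'. openin (zariski Y) U' \<and> x \<in> U' \<and>
                       (\<exists>g \<in> regular Y U'. \<forall>y \<in> U \<inter> U'. h y = g y)}) \<rparr>"

text \<open>The elements of \<open>O(U) \<otimes> O(V)\<close> as functions on \<open>U \<times> V\<close>. They cut out the basic open
  subsets of the product variety, and its regular functions are locally their quotients.\<close>

definition product_functions ::
    "('a, 'k::field) fun_space \<Rightarrow> ('b, 'k) fun_space \<Rightarrow> 'a set \<Rightarrow> 'b set \<Rightarrow> ('a \<times> 'b \<Rightarrow> 'k) set" where
  "product_functions X Y U V =
     {\<lambda>(x, y). \<Sum>i<n. f i x * g i y | (n::nat) f g. \<forall>i<n. f i \<in> regular X U \<and> g i \<in> regular Y V}"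

definition product_variety ::
    "('a, 'k::field) fun_space \<Rightarrow> ('b, 'k) fun_space \<Rightarrow> ('a \<times> 'b, 'k) fun_space" where
  "product_variety X Y =
     (let T = topology_generated_by
                {{z \<in> U \<times> V. t z \<noteq> 0} | U V t. openin (zariski X) U \<and> openin (zariski Y) V \<and>
                                                 t \<in> product_functions X Y U V}
      in \<lparr> zariski = T,
           regular = (\<lambda>W. {h \<in> extensional W. \<forall>z \<in> W. \<exists>W' U V. openin T W' \<and> z \<in> W' \<and> W' \<subseteq> W \<and>
              openin (zariski X) U \<and> openin (zariski Y) V \<and> W' \<subseteq> U \<times> V \<and>
              (\<exists>s \<in> product_functions X Y U V. \<exists>t \<in> product_functions X Y U V.
                 \<forall>y \<in> W'. t y \<noteq> 0 \<and> h y = s y / t y)}) \<rparr>)"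

subsection \<open>Affine varieties\<close>

text \<open>The algebra of functions on \<open>X\<close> generated by \<open>B\<close>.\<close>

inductive_set fun_algebra :: "'a set \<Rightarrow> ('a \<Rightarrow> 'k::field) set \<Rightarrow> ('a \<Rightarrow> 'k) set" for X B where
  const: "(\<lambda>x\<in>X. c) \<in> fun_algebra X B"
| gen: "f \<in> B \<Longrightarrow> restrict f X \<in> fun_algebra X B"
| add: "f \<in> fun_algebra X B \<Longrightarrow> g \<in> fun_algebra X B \<Longrightarrow> (\<lambda>x\<in>X. f x + g x) \<in> fun_algebra X B"
| mult: "f \<in> fun_algebra X B \<Longrightarrow> g \<in> fun_algebra X B \<Longrightarrow> (\<lambda>x\<in>X. f x * g x) \<in> fun_algebra X B"

text \<open>The ideal of the algebra \<open>A\<close> of functions on \<open>X\<close> generated by \<open>S\<close>.\<close>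

definition fun_ideal :: "'a set \<Rightarrow> ('a \<Rightarrow> 'k::field) set \<Rightarrow> ('a \<Rightarrow> 'k) set \<Rightarrow> ('a \<Rightarrow> 'k) set" where
  "fun_ideal X A S =
     {\<lambda>x\<in>X. \<Sum>i<n. a i x * s i x | (n::nat) a s. \<forall>i<n. a i \<in> A \<and> s i \<in> S}"

definition affine_fun_space :: "'a set \<Rightarrow> ('a \<Rightarrow> 'k::field) set \<Rightarrow> ('a, 'k) fun_space" where
  "affine_fun_space X A =
     (let T = topology_generated_by {{x \<in> X. f x \<noteq> 0} | f. f \<in> A}
      in \<lparr> zariski = T,
           regular = (\<lambda>U. {h \<in> extensional U. \<forall>x \<in> U. \<exists>U'. openin T U' \<and> x \<in> U' \<and> U' \<subseteq> U \<and>
              (\<exists>f \<in> A. \<exists>g \<in> A. \<forall>y \<in> U'. g y \<noteq> 0 \<and> h y = f y / g y)}) \<rparr>)"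

text \<open>An affine variety in intrinsic form: a set with a finitely generated algebra of functions
  such that evaluation identifies its points with the algebra homomorphisms to the ground field.\<close>

locale affine_variety =
  fixes X :: "'a set" and A :: "('a \<Rightarrow> 'k::field) set"
  assumes finitely_generated: "\<exists>B. finite B \<and> A = fun_algebra X B"
    and separates_points: "x \<in> X \<Longrightarrow> y \<in> X \<Longrightarrow> x \<noteq> y \<Longrightarrow> \<exists>f \<in> A. f x \<noteq> f y"
    and algebra_hom_is_evaluation:
      "\<lbrakk>\<And>c. \<chi> (\<lambda>x\<in>X. c) = c;
        \<And>f g. f \<in> A \<Longrightarrow> g \<in> A \<Longrightarrow> \<chi> (\<lambda>x\<in>X. f x + g x) = \<chi> f + \<chi> g;
        \<And>f g. f \<in> A \<Longrightarrow> g \<in> A \<Longrightarrow> \<chi> (\<lambda>x\<in>X. f x * g x) = \<chi> f * \<chi> g\<rbrakk>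
       \<Longrightarrow> \<exists>x \<in> X. \<forall>f \<in> A. \<chi> f = f x"

section \<open>Affine algebraic groups\<close>

record ('g, 'k) alg_group = "'g monoid" +
  coord :: "('g \<Rightarrow> 'k) set"

locale affine_algebraic_group =
  group G + affine_variety "carrier G" "coord G" for G :: "('g, 'k::field) alg_group" (structure) +
  assumes comultiplication:
      "f \<in> coord G \<Longrightarrow> \<exists>(n::nat) a b. (\<forall>i<n. a i \<in> coord G \<and> b i \<in> coord G) \<and>
         (\<forall>x \<in> carrier G. \<forall>y \<in> carrier G. f (x \<otimes> y) = (\<Sum>i<n. a i x * b i y))"
    and antipode: "f \<in> coord G \<Longrightarrow> (\<lambda>x\<in>carrier G. f (inv x)) \<in> coord G"

abbreviation group_zariski :: "('g, 'k::field) alg_group \<Rightarrow> 'g topology" where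
  "group_zariski G \<equiv> zariski (affine_fun_space (carrier G) (coord G))"

definition augmentation :: "('g, 'k::field) alg_group \<Rightarrow> ('g \<Rightarrow> 'k) set" where
  "augmentation G = {f \<in> coord G. f \<one>\<^bsub>G\<^esub> = 0}"

text \<open>Simple in the sense of algebraic groups (also called almost simple).\<close>

definition simple_algebraic_group :: "('g, 'k::field) alg_group \<Rightarrow> bool" where
  "simple_algebraic_group G \<longleftrightarrow>
     affine_algebraic_group G \<and> connected_space (group_zariski G) \<and> \<not> comm_group G \<and>
     (\<forall>N. N \<lhd> G \<and> closedin (group_zariski G) N \<and> connectedin (group_zariski G) N \<longrightarrow>
          N = {\<one>\<^bsub>G\<^esub>} \<or> N = carrier G)"

definition alg_group_hom :: "('g, 'k::field) alg_group \<Rightarrow> ('h, 'k) alg_group \<Rightarrow> ('g \<Rightarrow> 'h) \<Rightarrow> bool" where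
  "alg_group_hom H G \<phi> \<longleftrightarrow>
     \<phi> \<in> hom H G \<and> (\<forall>f \<in> coord G. (\<lambda>x\<in>carrier H. f (\<phi> x)) \<in> coord H)"

definition alg_group_iso :: "('g, 'k::field) alg_group \<Rightarrow> ('h, 'k) alg_group \<Rightarrow> ('g \<Rightarrow> 'h) \<Rightarrow> bool" where
  "alg_group_iso H G \<phi> \<longleftrightarrow>
     alg_group_hom H G \<phi> \<and>
     (\<exists>\<psi>. alg_group_hom G H \<psi> \<and>
          (\<forall>x \<in> carrier H. \<psi> (\<phi> x) = x) \<and> (\<forall>y \<in> carrier G. \<phi> (\<psi> y) = y))"

text \<open>Centrality refers to the scheme-theoretic kernel of \<open>\<phi>\<close>: it is defined by the ideal
  generated by the pullbacks of the augmentation ideal, and it is central iff \<open>H\<close> acts trivially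
  by conjugation on its coordinate ring. (The Frobenius morphism has trivial kernel on points but
  is not central.)\<close>

definition central_isogeny :: "('g, 'k::field) alg_group \<Rightarrow> ('h, 'k) alg_group \<Rightarrow> ('g \<Rightarrow> 'h) \<Rightarrow> bool" where
  "central_isogeny H G \<phi> \<longleftrightarrow>
     alg_group_hom H G \<phi> \<and> \<phi> ` carrier H = carrier G \<and> finite (kernel H G \<phi>) \<and>
     (\<forall>h \<in> carrier H. \<forall>f \<in> coord H.
        (\<lambda>x\<in>carrier H. f (h \<otimes>\<^bsub>H\<^esub> x \<otimes>\<^bsub>H\<^esub> inv\<^bsub>H\<^esub> h) - f x)
          \<in> fun_ideal (carrier H) (coord H) {\<lambda>x\<in>carrier H. f' (\<phi> x) | f'. f' \<in> augmentation G})"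

text \<open>A semisimple group is simply connected iff every central isogeny onto it from a connected
  algebraic group is an isomorphism. Letting \<open>H\<close> range over groups on the point type \<open>'g\<close> of \<open>G\<close>
  loses nothing for infinite \<open>G\<close>: an isogeny has finite fibres, so \<open>H\<close> and \<open>G\<close> have the same
  cardinality and \<open>H\<close> can be transported to the set \<open>carrier G\<close>.\<close>

definition simply_connected_group :: "('g, 'k::field) alg_group \<Rightarrow> bool" where
  "simply_connected_group G \<longleftrightarrow>
     (\<forall>(H :: ('g, 'k) alg_group) \<phi>.
        affine_algebraic_group H \<and> connected_space (group_zariski H) \<and> central_isogeny H G \<phi>
        \<longrightarrow> alg_group_iso H G \<phi>)"

section \<open>Modules for the group and its Frobenius kernels\<close>

definition rational_module ::
    "('g, 'k::field) alg_group \<Rightarrow> ('k \<Rightarrow> 'v::ab_group_add \<Rightarrow> 'v) \<Rightarrow> ('g \<Rightarrow> 'v \<Rightarrow> 'v) \<Rightarrow> bool" where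
  "rational_module G scale \<rho> \<longleftrightarrow>
     (\<forall>x \<in> carrier G. Vector_Spaces.linear scale scale (\<rho> x)) \<and>
     (\<forall>v. \<rho> \<one>\<^bsub>G\<^esub> v = v) \<and>
     (\<forall>x \<in> carrier G. \<forall>y \<in> carrier G. \<forall>v. \<rho> (x \<otimes>\<^bsub>G\<^esub> y) v = \<rho> x (\<rho> y v)) \<and>
     (\<forall>l v. Vector_Spaces.linear scale (*) l \<longrightarrow> (\<lambda>x\<in>carrier G. l (\<rho> x v)) \<in> coord G)"

text \<open>The ideal \<open>I\<^sub>r\<close> of the \<open>r\<close>-th Frobenius kernel \<open>G\<^sub>r\<close>, i.e. of the fibre over the identity of
  the \<open>r\<close>-th Frobenius morphism, whose comorphism raises functions to the power \<open>p\<^sup>r\<close>. So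
  \<open>k[G\<^sub>r] = k[G] / I\<^sub>r\<close>.\<close>

definition frobenius_kernel_ideal :: "('g, 'k::field) alg_group \<Rightarrow> nat \<Rightarrow> ('g \<Rightarrow> 'k) set" where
  "frobenius_kernel_ideal G r =
     fun_ideal (carrier G) (coord G)
       {\<lambda>x\<in>carrier G. f x ^ (CHAR('k) ^ r) | f. f \<in> augmentation G}"

text \<open>For a subspace \<open>W\<close> of \<open>V\<close> and \<open>J \<subseteq> k[G]\<close>, the tensor product \<open>W \<otimes> J\<close> realised as a space of
  functions from \<open>G\<close> to \<open>W\<close>. The coaction on \<open>V\<close> sends \<open>v\<close> to \<open>x \<mapsto> \<rho> x v\<close> in \<open>V \<otimes> k[G]\<close>, and
  \<open>V \<otimes> k[G\<^sub>r] = (V \<otimes> k[G]) / (V \<otimes> I\<^sub>r)\<close>. In the two definitions that follow, elements of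
  \<open>W \<otimes> k[G\<^sub>r]\<close> are represented by elements \<open>F\<close> of \<open>W \<otimes> k[G]\<close>.\<close>

definition tensor_maps ::
    "('g, 'k::field) alg_group \<Rightarrow> ('k \<Rightarrow> 'v::ab_group_add \<Rightarrow> 'v) \<Rightarrow> 'v set \<Rightarrow> ('g \<Rightarrow> 'k) set
      \<Rightarrow> ('g \<Rightarrow> 'v) set" where
  "tensor_maps G scale W J =
     {\<lambda>x\<in>carrier G. \<Sum>i<n. scale (f i x) (w i) | (n::nat) f w. \<forall>i<n. f i \<in> J \<and> w i \<in> W}"

text \<open>\<open>W\<close> is a subcomodule of \<open>V\<close> over \<open>k[G\<^sub>r]\<close>: the coaction of \<open>V\<close> maps \<open>W\<close> into
  \<open>W \<otimes> k[G\<^sub>r]\<close>.\<close>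

definition Gr_submodule ::
    "('g, 'k::field) alg_group \<Rightarrow> nat \<Rightarrow> ('k \<Rightarrow> 'v::ab_group_add \<Rightarrow> 'v) \<Rightarrow> ('g \<Rightarrow> 'v \<Rightarrow> 'v)
      \<Rightarrow> 'v set \<Rightarrow> bool" where
  "Gr_submodule G r scale \<rho> W \<longleftrightarrow>
     module.subspace scale W \<and>
     (\<forall>w \<in> W. \<exists>F \<in> tensor_maps G scale W (coord G).
        (\<lambda>x\<in>carrier G. \<rho> x w - F x) \<in> tensor_maps G scale UNIV (frobenius_kernel_ideal G r))"

text \<open>\<open>Hom\<close> over \<open>G\<^sub>r\<close> between \<open>G\<^sub>r\<close>-submodules \<open>W\<^sub>1\<close>, \<open>W\<^sub>2\<close> of \<open>V\<close>: the linear maps \<open>f\<close> with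
  \<open>(f \<otimes> id) \<circ> \<Delta> = \<Delta> \<circ> f\<close>. Here \<open>F\<close> represents \<open>\<Delta> w\<close>.\<close>

definition Gr_hom ::
    "('g, 'k::field) alg_group \<Rightarrow> nat \<Rightarrow> ('k \<Rightarrow> 'v::ab_group_add \<Rightarrow> 'v) \<Rightarrow> ('g \<Rightarrow> 'v \<Rightarrow> 'v)
      \<Rightarrow> 'v set \<Rightarrow> 'v set \<Rightarrow> ('v \<Rightarrow> 'v) set" where
  "Gr_hom G r scale \<rho> W1 W2 =
     {f \<in> W1 \<rightarrow>\<^sub>E W2.
        (\<forall>u \<in> W1. \<forall>v \<in> W1. f (u + v) = f u + f v) \<and>
        (\<forall>c. \<forall>v \<in> W1. f (scale c v) = scale c (f v)) \<and>
        (\<forall>w \<in> W1. \<forall>F \<in> tensor_maps G scale W1 (coord G).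
           (\<lambda>x\<in>carrier G. \<rho> x w - F x) \<in> tensor_maps G scale UNIV (frobenius_kernel_ideal G r) \<longrightarrow>
           (\<lambda>x\<in>carrier G. \<rho> x (f w) - f (F x))
              \<in> tensor_maps G scale UNIV (frobenius_kernel_ideal G r))}"

definition Gr_isomorphic ::
    "('g, 'k::field) alg_group \<Rightarrow> nat \<Rightarrow> ('k \<Rightarrow> 'v::ab_group_add \<Rightarrow> 'v) \<Rightarrow> ('g \<Rightarrow> 'v \<Rightarrow> 'v)
      \<Rightarrow> 'v set \<Rightarrow> 'v set \<Rightarrow> bool" where
  "Gr_isomorphic G r scale \<rho> W1 W2 \<longleftrightarrow>
     (\<exists>f \<in> Gr_hom G r scale \<rho> W1 W2. \<exists>g \<in> Gr_hom G r scale \<rho> W2 W1.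
        (\<forall>v \<in> W1. g (f v) = v) \<and> (\<forall>v \<in> W2. f (g v) = v))"

definition Gr_aut ::
    "('g, 'k::field) alg_group \<Rightarrow> nat \<Rightarrow> ('k \<Rightarrow> 'v::ab_group_add \<Rightarrow> 'v) \<Rightarrow> ('g \<Rightarrow> 'v \<Rightarrow> 'v)
      \<Rightarrow> 'v set \<Rightarrow> ('v \<Rightarrow> 'v) set" where
  "Gr_aut G r scale \<rho> W =
     {f \<in> Gr_hom G r scale \<rho> W W. \<exists>g \<in> Gr_hom G r scale \<rho> W W.
        (\<forall>v \<in> W. g (f v) = v) \<and> (\<forall>v \<in> W. f (g v) = v)}"

text \<open>\<open>V = W \<oplus> W'\<close>, where \<open>V\<close> is the whole type.\<close>

definition complementary :: "'v::ab_group_add set \<Rightarrow> 'v set \<Rightarrow> bool" where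
  "complementary W W' \<longleftrightarrow> W \<inter> W' = {0} \<and> {w + w' | w w'. w \<in> W \<and> w' \<in> W'} = UNIV"

definition Gr_complement ::
    "('g, 'k::field) alg_group \<Rightarrow> nat \<Rightarrow> ('k \<Rightarrow> 'v::ab_group_add \<Rightarrow> 'v) \<Rightarrow> ('g \<Rightarrow> 'v \<Rightarrow> 'v)
      \<Rightarrow> 'v set \<Rightarrow> 'v set \<Rightarrow> bool" where
  "Gr_complement G r scale \<rho> W W' \<longleftrightarrow>
     Gr_submodule G r scale \<rho> W \<and> Gr_submodule G r scale \<rho> W' \<and> complementary W W'"

text \<open>The set \<open>\<XX>\<close> of all \<open>G\<^sub>r\<close>-summands of \<open>V\<close> isomorphic to \<open>W\<close>.\<close>

definition summands ::
    "('g, 'k::field) alg_group \<Rightarrow> nat \<Rightarrow> ('k \<Rightarrow> 'v::ab_group_add \<Rightarrow> 'v) \<Rightarrow> ('g \<Rightarrow> 'v \<Rightarrow> 'v)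
      \<Rightarrow> 'v set \<Rightarrow> 'v set set" where
  "summands G r scale \<rho> W =
     {W'. (\<exists>C. Gr_complement G r scale \<rho> W' C) \<and> Gr_isomorphic G r scale \<rho> W' W}"

definition decompositions ::
    "('g, 'k::field) alg_group \<Rightarrow> nat \<Rightarrow> ('k \<Rightarrow> 'v::ab_group_add \<Rightarrow> 'v) \<Rightarrow> ('g \<Rightarrow> 'v \<Rightarrow> 'v)
      \<Rightarrow> 'v set \<Rightarrow> 'v set \<Rightarrow> ('v set \<times> 'v set) set" where
  "decompositions G r scale \<rho> M N =
     {(M', N'). Gr_complement G r scale \<rho> M' N' \<and>
        Gr_isomorphic G r scale \<rho> M' M \<and> Gr_isomorphic G r scale \<rho> N' N}"

subsection \<open>Block decomposition of endomorphisms\<close>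

definition proj_along :: "'v::ab_group_add set \<Rightarrow> 'v set \<Rightarrow> 'v \<Rightarrow> 'v" where
  "proj_along M N v = (THE m. m \<in> M \<and> v - m \<in> N)"

text \<open>The components of \<open>X\<close> in \<open>End(M)\<close>, \<open>Hom(M, N)\<close>, \<open>Hom(N, M)\<close> and \<open>End(N)\<close>, in this order.\<close>

definition blocks :: "'v::ab_group_add set \<Rightarrow> 'v set \<Rightarrow> ('v \<Rightarrow> 'v)
    \<Rightarrow> ('v \<Rightarrow> 'v) \<times> ('v \<Rightarrow> 'v) \<times> ('v \<Rightarrow> 'v) \<times> ('v \<Rightarrow> 'v)" where
  "blocks M N X =
     (\<lambda>v\<in>M. proj_along M N (X v), \<lambda>v\<in>M. proj_along N M (X v),
      \<lambda>v\<in>N. proj_along M N (X v), \<lambda>v\<in>N. proj_along N M (X v))"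

text \<open>The element of \<open>End(V)\<close> corresponding to \<open>(b, c)\<close> in \<open>Hom(M, N) \<oplus> Hom(N, M)\<close>.\<close>

definition off_diagonal :: "'v::ab_group_add set \<Rightarrow> 'v set \<Rightarrow> ('v \<Rightarrow> 'v) \<Rightarrow> ('v \<Rightarrow> 'v) \<Rightarrow> 'v \<Rightarrow> 'v" where
  "off_diagonal M N b c v = b (proj_along M N v) + c (proj_along N M v)"

definition nilpotent_map :: "('v::zero \<Rightarrow> 'v) \<Rightarrow> bool" where
  "nilpotent_map X \<longleftrightarrow> (\<exists>n. \<forall>v. (X ^^ n) v = 0)"

section \<open>The varieties in question\<close>

text \<open>A vector space \<open>H\<close> of maps on \<open>M\<close> (with pointwise operations) as an affine space: its
  coordinate ring is generated by the linear functionals on \<open>H\<close>.\<close>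

definition functionals ::
    "('k::field \<Rightarrow> 'v::ab_group_add \<Rightarrow> 'v) \<Rightarrow> 'v set \<Rightarrow> ('v \<Rightarrow> 'v) set \<Rightarrow> (('v \<Rightarrow> 'v) \<Rightarrow> 'k) set" where
  "functionals scale M H =
     {l. (\<forall>f \<in> H. \<forall>g \<in> H. l (\<lambda>v\<in>M. f v + g v) = l f + l g) \<and>
         (\<forall>c. \<forall>f \<in> H. l (\<lambda>v\<in>M. scale c (f v)) = c * l f)}"

definition Hom_variety ::
    "('g, 'k::field) alg_group \<Rightarrow> nat \<Rightarrow> ('k \<Rightarrow> 'v::ab_group_add \<Rightarrow> 'v) \<Rightarrow> ('g \<Rightarrow> 'v \<Rightarrow> 'v)
      \<Rightarrow> 'v set \<Rightarrow> 'v set \<Rightarrow> ('v \<Rightarrow> 'v, 'k) fun_space" where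
  "Hom_variety G r scale \<rho> M N =
     (let H = Gr_hom G r scale \<rho> M N
      in affine_fun_space H (fun_algebra H (functionals scale M H)))"

definition frame ::
    "('k::field \<Rightarrow> 'v::ab_group_add \<Rightarrow> 'v) \<Rightarrow> nat \<Rightarrow> 'v set \<Rightarrow> (nat \<Rightarrow> 'v) \<Rightarrow> bool" where
  "frame scale m W w \<longleftrightarrow>
     inj_on w {..<m} \<and> \<not> module.dependent scale (w ` {..<m}) \<and> module.span scale (w ` {..<m}) = W"

text \<open>The determinant \<open>det (l\<^sub>i (w\<^sub>j))\<close> is the value of the linear form \<open>l\<^sub>0 \<and> \<dots> \<and> l\<^sub>m\<^sub>-\<^sub>1\<close> on
  \<open>w\<^sub>0 \<and> \<dots> \<and> w\<^sub>m\<^sub>-\<^sub>1\<close>, i.e. a homogeneous coordinate of the Pluecker embedding into the projective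
  space of the \<open>m\<close>-th exterior power of \<open>V\<close>. The following are the homogeneous polynomials of
  degree \<open>d\<close> in these coordinates, as functions of a frame \<open>w\<close>.\<close>

inductive pluecker_form ::
    "('k::field \<Rightarrow> 'v::ab_group_add \<Rightarrow> 'v) \<Rightarrow> nat \<Rightarrow> nat \<Rightarrow> ((nat \<Rightarrow> 'v) \<Rightarrow> 'k) \<Rightarrow> bool"
  for scale m where
  const: "pluecker_form scale m 0 (\<lambda>w. c)"
| add: "pluecker_form scale m d P \<Longrightarrow> pluecker_form scale m d Q
        \<Longrightarrow> pluecker_form scale m d (\<lambda>w. P w + Q w)"
| mult: "(\<forall>i<m. Vector_Spaces.linear scale (*) (l i)) \<Longrightarrow> pluecker_form scale m d P
        \<Longrightarrow> pluecker_form scale m (Suc d) (\<lambda>w. det (mat m m (\<lambda>(i, j). l i (w j))) * P w)"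

definition grassmannian ::
    "('k::field \<Rightarrow> 'v::ab_group_add \<Rightarrow> 'v) \<Rightarrow> nat \<Rightarrow> ('v set, 'k) fun_space" where
  "grassmannian scale m =
     (let T = topology_generated_by
                {{W. module.subspace scale W \<and> vector_space.dim scale W = m \<and>
                     (\<exists>w. frame scale m W w \<and> P w \<noteq> 0)} | d P. pluecker_form scale m d P}
      in \<lparr> zariski = T,
           regular = (\<lambda>U. {h \<in> extensional U. \<forall>W \<in> U. \<exists>U'. openin T U' \<and> W \<in> U' \<and> U' \<subseteq> U \<and>
              (\<exists>d P Q. pluecker_form scale m d P \<and> pluecker_form scale m d Q \<and>
                 (\<forall>W' \<in> U'. \<forall>w. frame scale m W' w \<longrightarrow> Q w \<noteq> 0 \<and> h W' = P w / Q w))}) \<rparr>)"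

definition summand_variety ::
    "('g, 'k::field) alg_group \<Rightarrow> nat \<Rightarrow> ('k \<Rightarrow> 'v::ab_group_add \<Rightarrow> 'v) \<Rightarrow> ('g \<Rightarrow> 'v \<Rightarrow> 'v)
      \<Rightarrow> 'v set \<Rightarrow> ('v set, 'k) fun_space" where
  "summand_variety G r scale \<rho> W =
     subvariety (grassmannian scale (vector_space.dim scale W)) (summands G r scale \<rho> W)"

end

theory Submission
  imports Defs
begin

text \<open>The group enters only through the linear endomorphisms of \<open>V\<close> that commute with \<open>G\<^sub>r\<close>. They
  form an algebra closed under inverses; \<open>G\<^sub>r\<close>-summands are the images of its idempotents, and
  homomorphisms between summands are restrictions of its elements.

  All five conditions say that no composite \<open>M \<rightarrow> N \<rightarrow> M\<close> has the eigenvalue \<open>1\<close>. If \<open>c (b m) = m\<close>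
  with \<open>m \<noteq> 0\<close>, the automorphism \<open>(1 - c) (1 + b)\<close> carries \<open>M\<close> to a summand meeting \<open>N\<close> in \<open>b m\<close>;
  rescaling \<open>b\<close> excludes every nonzero eigenvalue, hence gives nilpotency. Conversely, if a summand
  \<open>M'\<close> isomorphic to \<open>M\<close> meets \<open>N\<close> nontrivially, an isomorphism composed with projections has a
  fixed point.

  Under these conditions the summands isomorphic to \<open>M\<close> are the graphs of the maps \<open>b : M \<rightarrow> N\<close>.
  Pluecker coordinates of the graph are polynomials in \<open>b\<close>, and the matrix coefficients of \<open>b\<close> are
  quotients of Pluecker coordinates.\<close>

section \<open>Endomorphisms over the Frobenius kernel\<close>

text \<open>Working with \<open>Gr_hom\<close> directly is awkward: on a proper submodule it
  quantifies over representatives \<open>F\<close> with values in that submodule. On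
  \<open>V\<close> itself the map taking \<open>x\<close> to \<open>\<rho> x w\<close> is already a
  representative. A homomorphism out of a summand is therefore extended by zero on a complement, and
  composites, sums and inverses are formed in \<open>Endo\<close>, where the calculations rest on
  the closure of the representatives of zero under sums and under linear maps of \<open>V\<close>.
  The geometric obstacle is homogeneity. A regular function on the Grassmannian is locally a
  quotient of two forms of the same degree, evaluated on arbitrary frames, while polynomials on
  \<open>Hom M N\<close> have no preferred degree. A fixed frame of \<open>M\<close>, moved to the
  graph of \<open>b\<close>, depends affinely on \<open>b\<close>, and one Pluecker coordinate
  \<open>D\<close> equals 1 on all these frames. Powers of \<open>D\<close> thus adjust degrees
  without changing values, and polynomials in \<open>b\<close> correspond to forms in both
  directions.\<close>

lemma complementary_commute: "complementary W W' \<longleftrightarrow> complementary W' W"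
proof -
  have "{w + w' | w w'. w \<in> W \<and> w' \<in> W'} = {w + w' | w w'. w \<in> W' \<and> w' \<in> W}"
    by (metis (no_types, opaque_lifting) add.commute)
  then show ?thesis
    unfolding complementary_def by (simp add: Int_commute)
qed

lemma Gr_complement_commute: "Gr_complement G r scale \<rho> W W' \<longleftrightarrow> Gr_complement G r scale \<rho> W' W"
  unfolding Gr_complement_def using complementary_commute by metis

lemma tensor_maps_zero: "(\<lambda>x\<in>carrier G. 0) \<in> tensor_maps G scale W J"
  unfolding tensor_maps_def by (rule CollectI, rule exI[of _ 0]) auto

lemma tensor_mapsI:
  fixes n :: nat
  assumes "\<And>i. i < n \<Longrightarrow> f i \<in> J" "\<And>i. i < n \<Longrightarrow> w i \<in> W"
    and "\<And>x. x \<in> carrier G \<Longrightarrow> F x = (\<Sum>i<n. scale (f i x) (w i))"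
  shows "(\<lambda>x\<in>carrier G. F x) \<in> tensor_maps G scale W J"
proof -
  have "(\<lambda>x\<in>carrier G. F x) = (\<lambda>x\<in>carrier G. \<Sum>i<n. scale (f i x) (w i))"
    using assms(3) by (rule restrict_ext)
  then show ?thesis
    unfolding tensor_maps_def using assms(1,2)
    by (intro CollectI exI[of _ n] exI[of _ f] exI[of _ w]) simp
qed

lemma tensor_maps_add:
  assumes "(\<lambda>x\<in>carrier G. F x) \<in> tensor_maps G scale W J"
    and "(\<lambda>x\<in>carrier G. F' x) \<in> tensor_maps G scale W J"
  shows "(\<lambda>x\<in>carrier G. F x + F' x) \<in> tensor_maps G scale W J"
proof -
  obtain n f w where 1: "(\<lambda>x\<in>carrier G. F x) = (\<lambda>x\<in>carrier G. \<Sum>i<n. scale (f i x) (w i))"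
    "\<forall>i<n::nat. f i \<in> J \<and> w i \<in> W"
    using assms(1) unfolding tensor_maps_def by auto
  obtain n' f' w' where 2: "(\<lambda>x\<in>carrier G. F' x) = (\<lambda>x\<in>carrier G. \<Sum>i<n'. scale (f' i x) (w' i))"
    "\<forall>i<n'::nat. f' i \<in> J \<and> w' i \<in> W"
    using assms(2) unfolding tensor_maps_def by auto
  define g where "g i = (if i < n then f i else f' (i - n))" for i
  define u where "u i = (if i < n then w i else w' (i - n))" for i
  have split: "sum h {..<n + n'} = sum h {..<n} + (\<Sum>i<n'. h (n + i))" for h :: "nat \<Rightarrow> 'b"
    by (induction n') (auto simp: add.assoc)
  have "F x + F' x = (\<Sum>i<n + n'. scale (g i x) (u i))" if "x \<in> carrier G" for x
  proof -
    have "F x = (\<Sum>i<n. scale (f i x) (w i))" "F' x = (\<Sum>i<n'. scale (f' i x) (w' i))"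
      using fun_cong[OF 1(1), of x] fun_cong[OF 2(1), of x] that by auto
    then show ?thesis
      unfolding split by (simp add: g_def u_def)
  qed
  then show ?thesis
    by (rule tensor_mapsI[rotated 2]) (use 1(2) 2(2) in \<open>auto simp: g_def u_def\<close>)
qed

section \<open>Linear maps, linear forms and projections of a finite dimensional space\<close>

context finite_dimensional_vector_space
begin

abbreviation lin :: "('b \<Rightarrow> 'b) \<Rightarrow> bool" where
  "lin \<equiv> Vector_Spaces.linear scale scale"

abbreviation lin_form :: "('b \<Rightarrow> 'a) \<Rightarrow> bool" where
  "lin_form \<equiv> Vector_Spaces.linear scale (*)"

lemma vector_space_scalars: "vector_space ((*) :: 'a \<Rightarrow> 'a \<Rightarrow> 'a)"
  by unfold_locales (auto simp: algebra_simps)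

lemma lin_iff: "lin f \<longleftrightarrow> (\<forall>u v. f (u + v) = f u + f v) \<and> (\<forall>c v. f (scale c v) = scale c (f v))"
  unfolding Vector_Spaces.linear_iff using vector_space_axioms by auto

lemma lin_form_iff:
  "lin_form f \<longleftrightarrow> (\<forall>u v. f (u + v) = f u + f v) \<and> (\<forall>c v. f (scale c v) = c * f v)"
  unfolding Vector_Spaces.linear_iff using vector_space_axioms vector_space_scalars by auto

lemma
  assumes "lin f"
  shows lin_add: "f (u + v) = f u + f v" and lin_scale: "f (scale c v) = scale c (f v)"
    and lin_0: "f 0 = 0" and lin_diff: "f (u - v) = f u - f v"
    and lin_sum: "f (sum h S) = (\<Sum>i\<in>S. f (h i))"
proof -
  interpret module_hom scale scale f
    using assms by (simp add: module_hom_iff_linear)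
  show "f (u + v) = f u + f v" "f (scale c v) = scale c (f v)" "f 0 = 0" "f (u - v) = f u - f v"
    "f (sum h S) = (\<Sum>i\<in>S. f (h i))"
    by (simp_all add: add scale zero diff sum)
qed

lemma lin_form_add: "lin_form l \<Longrightarrow> l (u + v) = l u + l v"
  and lin_form_scale: "lin_form l \<Longrightarrow> l (scale c v) = c * l v"
  by (auto simp: lin_form_iff)

lemma lin_form_sum: "lin_form l \<Longrightarrow> l (sum h S) = (\<Sum>i\<in>S. l (h i))"
  by (induction S rule: infinite_finite_induct)
    (auto simp: lin_form_add lin_form_scale[of l 0 0, simplified])

lemma subspace_image: "lin f \<Longrightarrow> subspace W \<Longrightarrow> subspace (f ` W)"
  by (simp add: module_hom.subspace_image module_hom_iff_linear)

lemma dim_lin_image: "lin f \<Longrightarrow> inj_on f W \<Longrightarrow> subspace W \<Longrightarrow> dim (f ` W) = dim W"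
  using finite_dimensional_vector_space_pair_1.dim_image_eq[of scale Basis scale f W]
  by (metis finite_dimensional_vector_space_axioms finite_dimensional_vector_space_pair_1.intro
      span_eq_iff vector_space_axioms)

text \<open>Justifies the definite description in \<open>proj_along\<close>: two candidates differ
  by a vector lying in both subspaces, hence by 0.\<close>

lemma
  assumes W: "subspace W" and W': "subspace W'" and c: "complementary W W'"
  shows proj_along_mem: "proj_along W W' v \<in> W"
    and proj_along_diff_mem: "v - proj_along W W' v \<in> W'"
    and proj_along_unique: "m \<in> W \<Longrightarrow> v - m \<in> W' \<Longrightarrow> proj_along W W' v = m"
proof -
  have "v \<in> {w + w' | w w'. w \<in> W \<and> w' \<in> W'}"
    using c unfolding complementary_def by blast
  then obtain m0 n0 where "m0 \<in> W" "n0 \<in> W'" "v = m0 + n0"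
    by auto
  then have m0: "m0 \<in> W \<and> v - m0 \<in> W'"
    by simp
  have "a = b" if "a \<in> W \<and> v - a \<in> W'" "b \<in> W \<and> v - b \<in> W'" for a b
  proof -
    have "a - b \<in> W" "a - b \<in> W'"
      using that subspace_diff[OF W, of a b] subspace_diff[OF W', of "v - b" "v - a"] by auto
    then have "a - b = 0"
      using c unfolding complementary_def by blast
    then show "a = b"
      by simp
  qed
  then have "\<exists>!m. m \<in> W \<and> v - m \<in> W'"
    using m0 by auto
  then have *: "m \<in> W \<and> v - m \<in> W' \<longleftrightarrow> m = proj_along W W' v" for m
    unfolding proj_along_def by (metis (mono_tags, lifting) theI')
  then show "proj_along W W' v \<in> W" "v - proj_along W W' v \<in> W'"
    "m \<in> W \<Longrightarrow> v - m \<in> W' \<Longrightarrow> proj_along W W' v = m"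
    by metis+
qed

lemma
  assumes W: "subspace W" and W': "subspace W'" and c: "complementary W W'"
  shows proj_along_lin: "lin (proj_along W W')"
    and proj_along_id: "m \<in> W \<Longrightarrow> proj_along W W' m = m"
    and proj_along_0: "n \<in> W' \<Longrightarrow> proj_along W W' n = 0"
    and proj_along_swap: "proj_along W' W v = v - proj_along W W' v"
proof -
  note m = proj_along_mem[OF assms] and d = proj_along_diff_mem[OF assms]
    and u = proj_along_unique[OF assms]
  show "lin (proj_along W W')"
    unfolding lin_iff
  proof (intro conjI allI u)
    fix c v w
    show "proj_along W W' v + proj_along W W' w \<in> W" "scale c (proj_along W W' v) \<in> W"
      using m W by (auto intro: subspace_add subspace_scale)
    show "v + w - (proj_along W W' v + proj_along W W' w) \<in> W'"
      using subspace_add[OF W' d d, of v w] by (simp add: algebra_simps)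
    show "scale c v - scale c (proj_along W W' v) \<in> W'"
      using subspace_scale[OF W' d, of c v] by (simp add: scale_right_diff_distrib)
  qed
  show "m \<in> W \<Longrightarrow> proj_along W W' m = m"
    by (rule u) (auto simp: subspace_0[OF W'])
  show "n \<in> W' \<Longrightarrow> proj_along W W' n = 0"
    by (rule u) (auto simp: subspace_0[OF W])
  show "proj_along W' W v = v - proj_along W W' v"
    using m d by (intro proj_along_unique[OF W' W]) (use c complementary_commute in auto)
qed

text \<open>The kernel of the projection along \<open>N\<close>, restricted to \<open>M'\<close>, is
  the intersection of \<open>M'\<close> with \<open>N\<close>. So the projection is injective on
  \<open>M'\<close>, by dimension it is onto \<open>M\<close>, and every vector is congruent modulo
  \<open>N\<close> to one of \<open>M'\<close>. Later only trivial intersections have to be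
  checked.\<close>

lemma complementary_of_dim:
  assumes "complementary M N" "subspace M" "subspace N" "subspace M'"
    and "dim M' = dim M" and "M' \<inter> N = {0}"
  shows "complementary M' N"
proof -
  let ?p = "proj_along M N"
  note p = proj_along_lin[OF assms(2,3,1)]
  have "inj_on ?p M'"
  proof (rule inj_onI)
    fix x y assume xy: "x \<in> M'" "y \<in> M'" "?p x = ?p y"
    then have "?p (x - y) = 0"
      by (simp add: lin_diff[OF p])
    then have "x - y \<in> N"
      using proj_along_diff_mem[OF assms(2,3,1), of "x - y"] by simp
    moreover have "x - y \<in> M'"
      using xy assms(4) subspace_diff by blast
    ultimately have "x - y = 0"
      using assms(6) by blast
    then show "x = y"
      by simp
  qed
  then have "dim (?p ` M') = dim M"
    using dim_lin_image p assms(4,5) by metis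
  then have im: "?p ` M' = M"
    using subspace_dim_equal[of "?p ` M'" M] subspace_image[OF p assms(4)] assms(2)
      proj_along_mem[OF assms(2,3,1)] by auto
  have "v \<in> {w + w' | w w'. w \<in> M' \<and> w' \<in> N}" for v
  proof -
    obtain m' where m': "m' \<in> M'" "?p m' = ?p v"
      using im proj_along_mem[OF assms(2,3,1), of v] by (metis imageE)
    then have "?p (v - m') = 0"
      by (simp add: lin_diff[OF p])
    then have "v - m' \<in> N"
      using proj_along_diff_mem[OF assms(2,3,1), of "v - m'"] by simp
    then show ?thesis
      using m'(1) by (smt (verit, best) add.commute diff_add_cancel mem_Collect_eq)
  qed
  then show ?thesis
    using assms(6) unfolding complementary_def by blast
qed

end

section \<open>Endomorphisms commuting with the Frobenius kernel, modulo its ideal\<close>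

locale rational_representation =
  finite_dimensional_vector_space scale Basis
  for scale :: "'k::field \<Rightarrow> 'v::ab_group_add \<Rightarrow> 'v" and Basis :: "'v set" +
  fixes G :: "('g, 'k) alg_group" and r :: nat and \<rho> :: "'g \<Rightarrow> 'v \<Rightarrow> 'v"
  assumes rational: "rational_module G scale \<rho>"
begin

text \<open>The maps representing \<open>0\<close> in \<open>V \<otimes> k[G\<^sub>r]\<close>.\<close>

definition negligible :: "('g \<Rightarrow> 'v) \<Rightarrow> bool" where
  "negligible F \<longleftrightarrow>
     (\<lambda>x\<in>carrier G. F x) \<in> tensor_maps G scale UNIV (frobenius_kernel_ideal G r)"

lemma negligible_cong: "(\<And>x. x \<in> carrier G \<Longrightarrow> F x = F' x) \<Longrightarrow> negligible F \<longleftrightarrow> negligible F'"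
  unfolding negligible_def using restrict_ext[of "carrier G" F F'] by simp

lemma negligible_0: "negligible (\<lambda>x. 0)"
  unfolding negligible_def by (rule tensor_maps_zero)

lemma negligible_add: "negligible F \<Longrightarrow> negligible F' \<Longrightarrow> negligible (\<lambda>x. F x + F' x)"
  unfolding negligible_def by (rule tensor_maps_add)

lemma negligible_lin:
  assumes "negligible F" and h: "lin h"
  shows "negligible (\<lambda>x. h (F x))"
proof -
  obtain n f w where 1: "(\<lambda>x\<in>carrier G. F x) = (\<lambda>x\<in>carrier G. \<Sum>i<n. scale (f i x) (w i))"
    "\<forall>i<n::nat. f i \<in> frobenius_kernel_ideal G r"
    using assms(1) unfolding negligible_def tensor_maps_def by auto
  have "h (F x) = (\<Sum>i<n. scale (f i x) (h (w i)))" if "x \<in> carrier G" for x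
    using fun_cong[OF 1(1), of x] that by (simp add: lin_sum[OF h] lin_scale[OF h])
  then show ?thesis
    unfolding negligible_def by (rule tensor_mapsI[rotated 2]) (use 1(2) in auto)
qed

lemma negligible_diff: "negligible F \<Longrightarrow> negligible F' \<Longrightarrow> negligible (\<lambda>x. F x - F' x)"
  using negligible_add[of F "\<lambda>x. - F' x"] negligible_lin[of F' uminus] by (simp add: lin_iff)

lemma \<rho>_lin: "x \<in> carrier G \<Longrightarrow> lin (\<rho> x)"
  using rational unfolding rational_module_def by blast

text \<open>Expanding \<open>\<rho> x w\<close> in the basis gives matrix coefficients, which lie in
  \<open>coord G\<close> by rationality. With \<open>h\<close> a projection onto \<open>W\<close>
  this produces the \<open>W\<close>-valued representatives that \<open>Gr_submodule\<close> and
  \<open>Gr_hom\<close> ask for.\<close>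

lemma orbit_map_tensor:
  assumes h: "lin h" and "\<And>v. h v \<in> W"
  shows "(\<lambda>x\<in>carrier G. h (\<rho> x w)) \<in> tensor_maps G scale W (coord G)"
proof -
  obtain b where b: "bij_betw b {..<card Basis} Basis"
    using ex_bij_betw_nat_finite[OF finite_Basis] by (auto simp: atLeast0LessThan)
  define f where "f i = (\<lambda>x\<in>carrier G. representation Basis (\<rho> x w) (b i))" for i
  have "lin_form (\<lambda>v. representation Basis v (b i))" for i
    using linear_representation[OF independent_Basis span_Basis] .
  then have f: "f i \<in> coord G" for i
    using rational unfolding rational_module_def f_def by blast
  have "h (\<rho> x w) = (\<Sum>i<card Basis. scale (f i x) (h (b i)))" if x: "x \<in> carrier G" for x
  proof -
    have "\<rho> x w = (\<Sum>c\<in>Basis. scale (representation Basis (\<rho> x w) c) c)"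
      using sum_representation_eq[OF independent_Basis _ finite_Basis] span_Basis by auto
    also have "\<dots> = (\<Sum>i<card Basis. scale (f i x) (b i))"
      using x by (subst sum.reindex_bij_betw[OF b, symmetric]) (simp add: f_def)
    finally show ?thesis
      by (simp add: lin_sum[OF h] lin_scale[OF h])
  qed
  then show ?thesis
    by (rule tensor_mapsI[rotated 2]) (use f assms(2) in auto)
qed

text \<open>Testing one representative per vector suffices here, because on all of \<open>V\<close>
  the orbit map represents the coaction exactly. Agreement with the official notion is
  \<open>Gr_hom_UNIV\<close>.\<close>

definition Endo :: "('v \<Rightarrow> 'v) set" where
  "Endo = {f. lin f \<and> (\<forall>w. negligible (\<lambda>x. \<rho> x (f w) - f (\<rho> x w)))}"

lemma Endo_lin: "f \<in> Endo \<Longrightarrow> lin f"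
  unfolding Endo_def by blast

lemma Endo_id: "(\<lambda>v. v) \<in> Endo"
  unfolding Endo_def by (auto simp: lin_iff negligible_0)

lemma Endo_comp:
  assumes f: "f \<in> Endo" and g: "g \<in> Endo"
  shows "(\<lambda>v. f (g v)) \<in> Endo"
proof -
  have "negligible (\<lambda>x. \<rho> x (f (g w)) - f (g (\<rho> x w)))" for w
  proof -
    \<comment> \<open>The term \<open>f (\<rho> x (g w))\<close> is inserted: the first summand is
      the defect of \<open>f\<close> at \<open>g w\<close>, the second is \<open>f\<close> applied
      to the defect of \<open>g\<close> at \<open>w\<close>.\<close>
    have "negligible (\<lambda>x. (\<rho> x (f (g w)) - f (\<rho> x (g w))) + f (\<rho> x (g w) - g (\<rho> x w)))"
      using f g by (intro negligible_add negligible_lin[where h = f]) (auto simp: Endo_def)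
    then show ?thesis
      by (simp add: lin_diff[OF Endo_lin[OF f]])
  qed
  then show ?thesis
    using f g unfolding Endo_def by (auto simp: lin_iff)
qed

lemma Endo_add:
  assumes f: "f \<in> Endo" and g: "g \<in> Endo"
  shows "(\<lambda>v. f v + g v) \<in> Endo"
proof -
  have "negligible (\<lambda>x. \<rho> x (f w + g w) - (f (\<rho> x w) + g (\<rho> x w)))" for w
  proof -
    have "negligible (\<lambda>x. (\<rho> x (f w) - f (\<rho> x w)) + (\<rho> x (g w) - g (\<rho> x w)))"
      using f g by (intro negligible_add) (auto simp: Endo_def)
    then show ?thesis
      by (subst negligible_cong) (auto simp: lin_add[OF \<rho>_lin])
  qed
  then show ?thesis
    using f g unfolding Endo_def by (auto simp: lin_iff algebra_simps)
qed

lemma Endo_scale: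
  assumes f: "f \<in> Endo"
  shows "(\<lambda>v. scale c (f v)) \<in> Endo"
proof -
  have s: "lin (scale c)"
    by (simp add: lin_iff scale_right_distrib scale_left_commute)
  have "negligible (\<lambda>x. \<rho> x (scale c (f w)) - scale c (f (\<rho> x w)))" for w
  proof -
    have "negligible (\<lambda>x. scale c (\<rho> x (f w) - f (\<rho> x w)))"
      using f s by (intro negligible_lin[where h = "scale c"]) (auto simp: Endo_def)
    then show ?thesis
      by (subst negligible_cong) (auto simp: lin_scale[OF \<rho>_lin] scale_right_diff_distrib)
  qed
  then show ?thesis
    using f unfolding Endo_def by (auto simp: lin_iff scale_right_distrib scale_left_commute)
qed

lemma Endo_diff:
  assumes f: "f \<in> Endo" and g: "g \<in> Endo"
  shows "(\<lambda>v. f v - g v) \<in> Endo"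
  using Endo_add[OF f Endo_scale[OF g, of "-1"]] by simp

lemma Endo_inverse:
  assumes f: "f \<in> Endo" and "inj f"
  obtains g where "g \<in> Endo" "\<And>v. f (g v) = v" "\<And>v. g (f v) = v"
proof
  note l = Endo_lin[OF f]
  have s: "surj f"
    using linear_inj_imp_surj[OF l assms(2)] .
  show fg: "f (inv_into UNIV f v) = v" and gf: "inv_into UNIV f (f v) = v" for v
    using s assms(2) by (simp_all add: surj_f_inv_f)
  have g: "lin (inv_into UNIV f)"
    using inj_linear_imp_inv_linear l assms(2) .
  have "negligible (\<lambda>x. \<rho> x (inv_into UNIV f w) - inv_into UNIV f (\<rho> x w))" for w
  proof -
    \<comment> \<open>The inverse map applied to the defect of \<open>f\<close> at the preimage of
      \<open>w\<close> is minus the defect of the inverse at \<open>w\<close>; the next step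
      corrects the sign.\<close>
    have "negligible (\<lambda>x. inv_into UNIV f (\<rho> x (f (inv_into UNIV f w)) - f (\<rho> x (inv_into UNIV f w))))"
      using f g by (intro negligible_lin[where h = "inv_into UNIV f"]) (auto simp: Endo_def)
    then have "negligible (\<lambda>x. - (inv_into UNIV f (\<rho> x (f (inv_into UNIV f w)) - f (\<rho> x (inv_into UNIV f w)))))"
      by (rule negligible_lin) (simp add: lin_iff)
    then show ?thesis
      by (simp add: lin_diff[OF g] fg gf)
  qed
  then show "inv_into UNIV f \<in> Endo"
    using g unfolding Endo_def by blast
qed

text \<open>The coaction on the \<open>W\<close>-part of \<open>w\<close> has a
  \<open>W\<close>-valued representative, which the projection to \<open>W'\<close> kills; so
  \<open>?q (\<rho> x (?p w))\<close> is negligible, and likewise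
  \<open>?p (\<rho> x (?q w))\<close>. Their difference is exactly the defect of \<open>?p\<close>
  at \<open>w\<close>.\<close>

lemma Gr_complement_Endo:
  assumes "Gr_complement G r scale \<rho> W W'"
  shows "proj_along W W' \<in> Endo"
proof -
  have W: "subspace W" and W': "subspace W'" and c: "complementary W W'"
    using assms unfolding Gr_complement_def Gr_submodule_def by blast+
  let ?p = "proj_along W W'" and ?q = "proj_along W' W"
  have c': "complementary W' W"
    using c complementary_commute by blast
  have p: "lin ?p" and q: "lin ?q"
    using proj_along_lin W W' c c' by blast+
  have "negligible (\<lambda>x. \<rho> x (?p w) - ?p (\<rho> x w))" for w
  proof -
    obtain F where F: "F \<in> tensor_maps G scale W (coord G)" "negligible (\<lambda>x. \<rho> x (?p w) - F x)"
      using assms proj_along_mem[OF W W' c, of w]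
      unfolding Gr_complement_def Gr_submodule_def negligible_def by blast
    obtain F' where F': "F' \<in> tensor_maps G scale W' (coord G)"
      "negligible (\<lambda>x. \<rho> x (?q w) - F' x)"
      using assms proj_along_mem[OF W' W c', of w]
      unfolding Gr_complement_def Gr_submodule_def negligible_def by blast
    have FW: "F x \<in> W" if "x \<in> carrier G" for x
      using F(1) that W unfolding tensor_maps_def by (auto intro!: subspace_sum subspace_scale)
    have FW': "F' x \<in> W'" if "x \<in> carrier G" for x
      using F'(1) that W' unfolding tensor_maps_def by (auto intro!: subspace_sum subspace_scale)
    have "negligible (\<lambda>x. ?q (\<rho> x (?p w) - F x) - ?p (\<rho> x (?q w) - F' x))"
      using negligible_diff[OF negligible_lin[OF F(2) q] negligible_lin[OF F'(2) p]] .
    also have "?this \<longleftrightarrow> negligible (\<lambda>x. \<rho> x (?p w) - ?p (\<rho> x w))"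
    proof (rule negligible_cong)
      fix x assume x: "x \<in> carrier G"
      have qF: "?q (F x) = 0" and pF': "?p (F' x) = 0"
        using proj_along_0 W W' c c' FW[OF x] FW'[OF x] by blast+
      have "?p (\<rho> x (?q w)) = ?p (\<rho> x w) - ?p (\<rho> x (?p w))"
        by (simp add: proj_along_swap[OF W W' c, of w] lin_diff[OF \<rho>_lin[OF x]] lin_diff[OF p])
      moreover have "?q (\<rho> x (?p w)) = \<rho> x (?p w) - ?p (\<rho> x (?p w))"
        by (rule proj_along_swap[OF W W' c])
      ultimately show "?q (\<rho> x (?p w) - F x) - ?p (\<rho> x (?q w) - F' x) = \<rho> x (?p w) - ?p (\<rho> x w)"
        by (simp add: lin_diff[OF p] lin_diff[OF q] qF pF')
    qed
    finally show ?thesis .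
  qed
  then show ?thesis
    using p unfolding Endo_def by blast
qed

text \<open>A vector \<open>w\<close> of the range is fixed by \<open>e\<close>, so
  \<open>e (\<rho> x w)\<close> represents its coaction and has values in the range.\<close>

lemma Gr_submodule_range:
  assumes e: "e \<in> Endo" and idem: "\<And>v. e (e v) = e v"
  shows "Gr_submodule G r scale \<rho> (range e)"
proof -
  note l = Endo_lin[OF e]
  have "\<exists>F\<in>tensor_maps G scale (range e) (coord G).
          (\<lambda>x\<in>carrier G. \<rho> x w - F x) \<in> tensor_maps G scale UNIV (frobenius_kernel_ideal G r)"
    if "w \<in> range e" for w
  proof (rule bexI)
    show "(\<lambda>x\<in>carrier G. e (\<rho> x w)) \<in> tensor_maps G scale (range e) (coord G)"
      using orbit_map_tensor[OF l] by auto
    have "e w = w"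
      using that idem by auto
    moreover have "negligible (\<lambda>x. \<rho> x (e w) - e (\<rho> x w))"
      using e unfolding Endo_def by blast
    ultimately have "negligible (\<lambda>x. \<rho> x w - (\<lambda>x\<in>carrier G. e (\<rho> x w)) x)"
      by (subst negligible_cong[where F' = "\<lambda>x. \<rho> x w - e (\<rho> x w)"]) auto
    then show "(\<lambda>x\<in>carrier G. \<rho> x w - (\<lambda>x\<in>carrier G. e (\<rho> x w)) x)
        \<in> tensor_maps G scale UNIV (frobenius_kernel_ideal G r)"
      unfolding negligible_def .
  qed
  moreover have "subspace (range e)"
    using subspace_image[OF l subspace_UNIV] .
  ultimately show ?thesis
    unfolding Gr_submodule_def by blast
qed

text \<open>Removes tensor representatives from all later arguments about summands: what remains to
  be checked is linear algebra and one membership in \<open>Endo\<close>.\<close>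

lemma Gr_complement_iff:
  "Gr_complement G r scale \<rho> W W' \<longleftrightarrow>
     subspace W \<and> subspace W' \<and> complementary W W' \<and> proj_along W W' \<in> Endo"
proof
  assume "subspace W \<and> subspace W' \<and> complementary W W' \<and> proj_along W W' \<in> Endo"
  then have W: "subspace W" and W': "subspace W'" and c: "complementary W W'"
    and e: "proj_along W W' \<in> Endo"
    by auto
  let ?p = "proj_along W W'" and ?q = "proj_along W' W"
  have c': "complementary W' W"
    using c complementary_commute by blast
  have q: "?q = (\<lambda>v. v - ?p v)"
    using proj_along_swap[OF W W' c] by auto
  then have e': "?q \<in> Endo"
    using Endo_diff[OF Endo_id e] by simp
  have "range ?p = W" "range ?q = W'"
    using proj_along_mem[OF W W' c] proj_along_id[OF W W' c]
      proj_along_mem[OF W' W c'] proj_along_id[OF W' W c'] by (metis image_subset_iff rangeI subsetI subset_antisym)+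
  then show "Gr_complement G r scale \<rho> W W'"
    using Gr_submodule_range[OF e] Gr_submodule_range[OF e'] c
      proj_along_mem[OF W W' c] proj_along_id[OF W W' c]
      proj_along_mem[OF W' W c'] proj_along_id[OF W' W c']
    unfolding Gr_complement_def by simp
next
  assume "Gr_complement G r scale \<rho> W W'"
  then show "subspace W \<and> subspace W' \<and> complementary W W' \<and> proj_along W W' \<in> Endo"
    using Gr_complement_Endo unfolding Gr_complement_def Gr_submodule_def by blast
qed

text \<open>The representative \<open>F\<close> is arbitrary, and the error
  \<open>\<rho> x w - F x\<close> need not lie in \<open>W1\<close>; it can be fed to
  \<open>h\<close> because \<open>h\<close> is defined and linear on all of
  \<open>V\<close>.\<close>

lemma restrict_Endo_Gr_hom:
  assumes h: "h \<in> Endo" and W1: "subspace W1" and im: "\<And>v. v \<in> W1 \<Longrightarrow> h v \<in> W2"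
  shows "restrict h W1 \<in> Gr_hom G r scale \<rho> W1 W2"
proof -
  note l = Endo_lin[OF h]
  have "(\<lambda>x\<in>carrier G. \<rho> x (restrict h W1 w) - restrict h W1 (F x))
          \<in> tensor_maps G scale UNIV (frobenius_kernel_ideal G r)"
    if w: "w \<in> W1" and F: "F \<in> tensor_maps G scale W1 (coord G)"
      "(\<lambda>x\<in>carrier G. \<rho> x w - F x) \<in> tensor_maps G scale UNIV (frobenius_kernel_ideal G r)" for w F
  proof -
    have FW: "F x \<in> W1" if "x \<in> carrier G" for x
      using F(1) that W1 unfolding tensor_maps_def by (auto intro!: subspace_sum subspace_scale)
    have "negligible (\<lambda>x. (\<rho> x (h w) - h (\<rho> x w)) + h (\<rho> x w - F x))"
      using h F(2) l by (intro negligible_add negligible_lin[where h = h]) (auto simp: Endo_def negligible_def)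
    also have "?this \<longleftrightarrow> negligible (\<lambda>x. \<rho> x (restrict h W1 w) - restrict h W1 (F x))"
      by (rule negligible_cong) (simp add: w FW lin_diff[OF l])
    finally show ?thesis
      unfolding negligible_def .
  qed
  then show ?thesis
    unfolding Gr_hom_def using im W1
    by (auto simp: lin_add[OF l] lin_scale[OF l] subspace_add subspace_scale)
qed

text \<open>The hypothesis on \<open>f\<close> is used with the \<open>W1\<close>-valued
  representative obtained by projecting the orbit map of the \<open>W1\<close>-part of
  \<open>w\<close>. The remaining error is the extended map applied to the defect of the projection
  at \<open>w\<close>.\<close>

lemma Gr_hom_extend:
  assumes f: "f \<in> Gr_hom G r scale \<rho> W1 W2" and c: "Gr_complement G r scale \<rho> W1 C"
  shows "(\<lambda>v. f (proj_along W1 C v)) \<in> Endo"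
proof -
  have W: "subspace W1" and W': "subspace C" and cc: "complementary W1 C"
    and e: "proj_along W1 C \<in> Endo"
    using c Gr_complement_iff by auto
  let ?p = "proj_along W1 C"
  note p = proj_along_lin[OF W W' cc] and pm = proj_along_mem[OF W W' cc]
    and pi = proj_along_id[OF W W' cc]
  have h: "lin (\<lambda>v. f (?p v))"
    using f pm unfolding lin_iff Gr_hom_def by (simp add: lin_add[OF p] lin_scale[OF p])
  have "negligible (\<lambda>x. \<rho> x (f (?p w)) - f (?p (\<rho> x w)))" for w
  proof -
    let ?F = "\<lambda>x\<in>carrier G. ?p (\<rho> x (?p w))"
    have "negligible (\<lambda>x. \<rho> x (?p (?p w)) - ?p (\<rho> x (?p w)))"
      using e unfolding Endo_def by blast
    also have "?this \<longleftrightarrow> negligible (\<lambda>x. \<rho> x (?p w) - ?F x)"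
      by (rule negligible_cong) (simp add: pi[OF pm])
    finally have "negligible (\<lambda>x. \<rho> x (f (?p w)) - f (?F x))"
      using f pm orbit_map_tensor[OF p pm] unfolding Gr_hom_def negligible_def by blast
    moreover have "negligible (\<lambda>x. f (?p (\<rho> x (?p w) - ?p (\<rho> x w))))"
      using h e by (intro negligible_lin[where h = "\<lambda>v. f (?p v)"]) (auto simp: Endo_def)
    ultimately have "negligible (\<lambda>x. (\<rho> x (f (?p w)) - f (?F x)) + f (?p (\<rho> x (?p w) - ?p (\<rho> x w))))"
      by (rule negligible_add)
    also have "?this \<longleftrightarrow> ?thesis"
    proof (rule negligible_cong)
      fix x assume "x \<in> carrier G"
      then show "(\<rho> x (f (?p w)) - f (?F x)) + f (?p (\<rho> x (?p w) - ?p (\<rho> x w)))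
          = \<rho> x (f (?p w)) - f (?p (\<rho> x w))"
        using lin_diff[OF h, of "\<rho> x (?p w)" "?p (\<rho> x w)"] by (simp add: pi[OF pm])
    qed
    finally show ?thesis .
  qed
  then show ?thesis
    using h unfolding Endo_def by blast
qed

lemma Gr_hom_mem: "f \<in> Gr_hom G r scale \<rho> W1 W2 \<Longrightarrow> v \<in> W1 \<Longrightarrow> f v \<in> W2"
  unfolding Gr_hom_def by (auto simp: PiE_iff)

lemma Gr_hom_extensional: "f \<in> Gr_hom G r scale \<rho> W1 W2 \<Longrightarrow> f \<in> extensional W1"
  unfolding Gr_hom_def by (auto simp: PiE_iff)

lemma Gr_hom_UNIV: "Gr_hom G r scale \<rho> UNIV UNIV = Endo"
proof -
  have c: "complementary (UNIV :: 'v set) {0}"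
    unfolding complementary_def by auto
  have "proj_along (UNIV :: 'v set) {0} = (\<lambda>v. v)"
    using proj_along_id[OF subspace_UNIV subspace_single_0 c] by (intro ext) simp
  moreover from this have "Gr_complement G r scale \<rho> UNIV {0}"
    using Gr_complement_iff c subspace_UNIV subspace_single_0 Endo_id by simp
  ultimately show ?thesis
    using Gr_hom_extend[of _ UNIV UNIV "{0}"] restrict_Endo_Gr_hom[of _ UNIV UNIV] subspace_UNIV
    by (auto simp: restrict_UNIV)
qed

end

section \<open>The equivalent conditions\<close>

text \<open>Induction on the degree of a polynomial annihilating \<open>v\<close>: a linear factor \<open>T - a\<close> with
  \<open>a \<noteq> 0\<close> is injective and can be cancelled, and the factors \<open>T\<close> remain.\<close>

lemma funpow_zero_if_no_eigenvector:
  fixes scale :: "'k::alg_closed_field \<Rightarrow> 'v::ab_group_add \<Rightarrow> 'v"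
  assumes "finite_dimensional_vector_space scale Basis"
    and lin: "Vector_Spaces.linear scale scale T"
    and no_ev: "\<And>a v. a \<noteq> 0 \<Longrightarrow> T v = scale a v \<Longrightarrow> v = 0"
    and "p \<noteq> 0" "degree p \<le> n" "(\<Sum>i\<le>n. scale (coeff p i) ((T ^^ i) v)) = 0"
  shows "(T ^^ n) v = 0"
  using assms(4-6)
proof (induction n arbitrary: p v)
  case 0
  interpret finite_dimensional_vector_space scale Basis by fact
  have "coeff p 0 \<noteq> 0"
    using 0(1,2) by (metis le_zero_eq leading_coeff_0_iff)
  then show ?case
    using 0(3) by simp
next
  case (Suc n)
  interpret finite_dimensional_vector_space scale Basis by fact
  note T = lin_0[OF lin] lin_sum[OF lin] lin_scale[OF lin]
  show ?case
  proof (cases "degree p \<le> n")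
    case True
    then have "(\<Sum>i\<le>n. scale (coeff p i) ((T ^^ i) v)) = 0"
      using Suc(4) by (simp add: coeff_eq_0)
    then show ?thesis
      using Suc.IH[OF Suc(2) True] by (simp add: T)
  next
    case False
    then have deg: "degree p = Suc n"
      using Suc(3) by simp
    then obtain a where "poly p a = 0"
      using alg_closed_imp_poly_has_root[of p] by auto
    then obtain q where q: "p = [:- a, 1:] * q"
      by (auto simp: poly_eq_0_iff_dvd dvd_def)
    have "q \<noteq> 0"
      using q Suc(2) by auto
    then have degq: "degree q = n"
      using deg unfolding q by (subst (asm) degree_mult_eq) auto
    define u where "u = (\<Sum>i\<le>n. scale (coeff q i) ((T ^^ i) v))"
    \<comment> \<open>\<open>u\<close> is \<open>q(T)\<close> applied to \<open>v\<close>.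
      Evaluating \<open>q(T)\<close> at \<open>T v\<close> gives \<open>T u\<close>, so in the case
      \<open>a = 0\<close> the induction hypothesis can be applied to \<open>T v\<close>.\<close>
    have Tu: "(\<Sum>i\<le>n. scale (coeff q i) ((T ^^ i) (T v))) = T u"
      by (simp add: u_def T funpow_swap1)
    have "0 = (\<Sum>i\<le>Suc n. scale (coeff p i) ((T ^^ i) v))"
      using Suc(4) by simp
    \<comment> \<open>\<open>pCons 0 q\<close> is the indeterminate times \<open>q\<close>; the
      splitting of \<open>p\<close> thus expresses the vanishing sum as \<open>T u\<close> minus
      \<open>a\<close> times \<open>u\<close>.\<close>
    also have "\<dots> = (\<Sum>i\<le>Suc n. scale (coeff (pCons 0 q) i) ((T ^^ i) v)
        - scale a (scale (coeff q i) ((T ^^ i) v)))"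
      by (rule sum.cong) (simp_all add: q scale_left_diff_distrib)
    also have "\<dots> = (\<Sum>i\<le>Suc n. scale (coeff (pCons 0 q) i) ((T ^^ i) v))
        - scale a (\<Sum>i\<le>Suc n. scale (coeff q i) ((T ^^ i) v))"
      by (simp add: sum_subtractf scale_sum_right del: sum.atMost_Suc)
    also have "(\<Sum>i\<le>Suc n. scale (coeff q i) ((T ^^ i) v)) = u"
      using degq by (simp add: u_def coeff_eq_0)
    also have "(\<Sum>i\<le>Suc n. scale (coeff (pCons 0 q) i) ((T ^^ i) v)) = T u"
      by (subst sum.atMost_Suc_shift) (simp add: Tu[symmetric] funpow_swap1)
    finally have ev: "T u = scale a u"
      by simp
    show ?thesis
    proof (cases "a = 0")
      case True
      then have "(T ^^ n) (T v) = 0"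
        using ev Suc.IH[OF \<open>q \<noteq> 0\<close>, of "T v"] degq by (simp add: Tu)
      then show ?thesis
        by (simp add: funpow_swap1)
    next
      case False
      then have "(T ^^ n) v = 0"
        using no_ev[OF False ev] Suc.IH[OF \<open>q \<noteq> 0\<close>, of v] degq by (simp add: u_def)
      then show ?thesis
        by (simp add: T)
    qed
  qed
qed

text \<open>The \<open>D + 1\<close> iterates of \<open>T\<close> on \<open>v\<close> from exponent
  0 to \<open>D\<close>, the dimension, satisfy a linear relation, which is an annihilating
  polynomial of degree at most \<open>D\<close>. The exponent \<open>D\<close> then serves all
  \<open>v\<close> at once.\<close>

lemma nilpotent_if_no_eigenvector:
  fixes scale :: "'k::alg_closed_field \<Rightarrow> 'v::ab_group_add \<Rightarrow> 'v"
  assumes fin: "finite_dimensional_vector_space scale Basis"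
    and lin: "Vector_Spaces.linear scale scale T"
    and no_ev: "\<And>a v. a \<noteq> 0 \<Longrightarrow> T v = scale a v \<Longrightarrow> v = 0"
  shows "nilpotent_map T"
proof -
  interpret finite_dimensional_vector_space scale Basis by fact
  define D where "D = card Basis"
  have "(T ^^ D) v = 0" for v
  proof -
    let ?t = "\<lambda>i. (T ^^ i) v"
    obtain c k where c: "k \<le> D" "c k \<noteq> 0" "(\<Sum>i\<le>D. scale (c i) (?t i)) = 0"
    proof (cases "inj_on ?t {..D}")
      case True
      have "dim (?t ` {..D}) < card (?t ` {..D})"
        using dim_subset_UNIV[of "?t ` {..D}"] card_image[OF True]
        by (simp add: D_def dimension_def)
      then have "dependent (?t ` {..D})"
        using dependent_biggerset_general by blast
      then obtain u where u: "\<exists>w\<in>?t ` {..D}. u w \<noteq> 0" "(\<Sum>w\<in>?t ` {..D}. scale (u w) w) = 0"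
        using dependent_finite[of "?t ` {..D}"] by auto
      then obtain k where "k \<le> D" "u (?t k) \<noteq> 0"
        by auto
      then show ?thesis
        using u(2) that[of k "\<lambda>i. u (?t i)"] by (simp add: sum.reindex[OF True])
    next
      \<comment> \<open>\<open>dependent\<close> speaks of sets and does not see repetitions; two
        equal iterates give the relation with coefficients 1 and -1.\<close>
      case False
      then obtain i j where ij: "i \<le> D" "j \<le> D" "i \<noteq> j" "?t i = ?t j"
        unfolding inj_on_def by auto
      let ?c = "\<lambda>l. (if l = i then 1 else 0) - (if l = j then 1 else 0) :: 'k"
      have "(\<Sum>l\<le>D. scale (?c l) (?t l))
          = (\<Sum>l\<le>D. if l = i then ?t l else 0) - (\<Sum>l\<le>D. if l = j then ?t l else 0)"
        unfolding sum_subtractf[symmetric]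
        by (rule sum.cong) (auto simp: scale_left_diff_distrib)
      also have "\<dots> = 0"
        using ij by simp
      finally show ?thesis
        using ij(1,3) that[of i ?c] by simp
    qed
    define p where "p = (\<Sum>i\<le>D. monom (c i) i)"
    have p: "coeff p i = (if i \<le> D then c i else 0)" for i
      by (simp add: p_def coeff_sum)
    then have "p \<noteq> 0"
      using c(1,2) by (metis coeff_0)
    moreover have "degree p \<le> D"
      using p by (simp add: degree_le)
    moreover have "(\<Sum>i\<le>D. scale (coeff p i) (?t i)) = 0"
      using c(3) p by simp
    ultimately show ?thesis
      using funpow_zero_if_no_eigenvector[OF fin lin, of p D v] no_ev by blast
  qed
  then show ?thesis
    unfolding nilpotent_map_def by blast
qed

section \<open>Automorphisms and images of summands\<close>

context rational_representation
begin

abbreviation "Hom \<equiv> Gr_hom G r scale \<rho>"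

lemma
  assumes f: "f \<in> Hom W1 W2"
  shows Gr_hom_scale: "v \<in> W1 \<Longrightarrow> f (scale c v) = scale c (f v)"
    and Gr_hom_minus: "v \<in> W1 \<Longrightarrow> f (- v) = - f v"
    and Gr_hom_0: "subspace W1 \<Longrightarrow> f 0 = 0"
proof -
  show sc: "v \<in> W1 \<Longrightarrow> f (scale c v) = scale c (f v)" for v c
    using f unfolding Gr_hom_def by blast
  show "v \<in> W1 \<Longrightarrow> f (- v) = - f v"
    using sc[of v "-1"] by simp
  show "subspace W1 \<Longrightarrow> f 0 = 0"
    using sc[of 0 0] subspace_0 by simp
qed

text \<open>The projection belonging to the image decomposition is the conjugate of the old one by
  \<open>f\<close>, hence again in \<open>Endo\<close>.\<close>

lemma Gr_complement_image:
  assumes f: "f \<in> Endo" and inj: "inj f" and c: "Gr_complement G r scale \<rho> W W'"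
  shows "Gr_complement G r scale \<rho> (f ` W) (f ` W')"
    and "Gr_isomorphic G r scale \<rho> (f ` W) W"
proof -
  obtain g where g: "g \<in> Endo" "\<And>v. f (g v) = v" "\<And>v. g (f v) = v"
    using Endo_inverse[OF f inj] by blast
  have W: "subspace W" and W': "subspace W'" and cc: "complementary W W'"
    and e: "proj_along W W' \<in> Endo"
    using c Gr_complement_iff by auto
  note l = Endo_lin[OF f]
  have fW: "subspace (f ` W)" "subspace (f ` W')"
    using subspace_image l W W' by auto
  have "f ` W \<inter> f ` W' = f ` (W \<inter> W')"
    using image_Int[OF inj] by metis
  then have "f ` W \<inter> f ` W' = {0}"
    using cc by (simp add: complementary_def lin_0[OF l])
  moreover have "v \<in> {w + w' | w w'. w \<in> f ` W \<and> w' \<in> f ` W'}" for v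
  proof -
    have "g v \<in> {w + w' | w w'. w \<in> W \<and> w' \<in> W'}"
      using cc by (simp add: complementary_def)
    then obtain w w' where "g v = w + w'" "w \<in> W" "w' \<in> W'"
      by blast
    then have "v = f w + f w'"
      by (metis g(2) lin_add[OF l])
    then show ?thesis
      using \<open>w \<in> W\<close> \<open>w' \<in> W'\<close> by blast
  qed
  ultimately have fc: "complementary (f ` W) (f ` W')"
    unfolding complementary_def by blast
  have "proj_along (f ` W) (f ` W') = (\<lambda>v. f (proj_along W W' (g v)))"
  proof
    fix v
    have "v - f (proj_along W W' (g v)) = f (g v - proj_along W W' (g v))"
      by (simp add: lin_diff[OF l] g)
    then show "proj_along (f ` W) (f ` W') v = f (proj_along W W' (g v))"
      using proj_along_mem[OF W W' cc] proj_along_diff_mem[OF W W' cc]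
      by (intro proj_along_unique[OF fW fc]) auto
  qed
  then show "Gr_complement G r scale \<rho> (f ` W) (f ` W')"
    using Gr_complement_iff fW fc Endo_comp[OF f Endo_comp[OF e g(1)]] by simp
  have "restrict g (f ` W) \<in> Hom (f ` W) W" "restrict f W \<in> Hom W (f ` W)"
    using f g W fW by (auto intro!: restrict_Endo_Gr_hom)
  then show "Gr_isomorphic G r scale \<rho> (f ` W) W"
    unfolding Gr_isomorphic_def
    by (intro bexI[of _ "restrict g (f ` W)"] bexI[of _ "restrict f W"]) (auto simp: g)
qed

lemma Gr_isomorphic_dim:
  assumes "Gr_isomorphic G r scale \<rho> W1 W2" "Gr_complement G r scale \<rho> W1 C"
  shows "dim W1 = dim W2"
proof -
  obtain f g where fg: "f \<in> Hom W1 W2" "g \<in> Hom W2 W1" "\<And>v. v \<in> W1 \<Longrightarrow> g (f v) = v"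
    "\<And>v. v \<in> W2 \<Longrightarrow> f (g v) = v"
    using assms(1) unfolding Gr_isomorphic_def by blast
  have W: "subspace W1" and C: "subspace C" and cc: "complementary W1 C"
    using assms(2) Gr_complement_iff by auto
  let ?f = "\<lambda>v. f (proj_along W1 C v)"
  have id: "?f v = f v" if "v \<in> W1" for v
    using proj_along_id[OF W C cc that] by simp
  have "lin ?f"
    using Gr_hom_extend[OF fg(1) assms(2)] Endo_lin by blast
  moreover have "inj_on ?f W1"
    by (rule inj_on_inverseI[of _ g]) (simp add: id fg)
  ultimately have "dim (?f ` W1) = dim W1"
    using dim_lin_image W by blast
  moreover have "?f ` W1 = W2"
  proof
    show "?f ` W1 \<subseteq> W2"
      using Gr_hom_mem[OF fg(1)] by (auto simp: id)
    show "W2 \<subseteq> ?f ` W1"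
    proof
      fix w assume w: "w \<in> W2"
      then have "w = ?f (g w)"
        using id[OF Gr_hom_mem[OF fg(2) w]] fg(4) by simp
      then show "w \<in> ?f ` W1"
        using Gr_hom_mem[OF fg(2) w] by (rule image_eqI)
    qed
  qed
  ultimately show ?thesis
    by simp
qed

text \<open>Extended by the identity on the complement, an injective \<open>f\<close> becomes an
  injective element of \<open>Endo\<close>, which has an inverse there by finite dimension. The
  restriction of that inverse to \<open>W\<close> is the inverse of \<open>f\<close>.\<close>

lemma Gr_aut_eq:
  assumes c: "Gr_complement G r scale \<rho> W C"
  shows "Gr_aut G r scale \<rho> W = {f \<in> Hom W W. inj_on f W}"
proof
  show "Gr_aut G r scale \<rho> W \<subseteq> {f \<in> Hom W W. inj_on f W}"
    unfolding Gr_aut_def by (auto intro: inj_on_inverseI)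
  show "{f \<in> Hom W W. inj_on f W} \<subseteq> Gr_aut G r scale \<rho> W"
  proof safe
    fix f assume f: "f \<in> Hom W W" and inj: "inj_on f W"
    have W: "subspace W" and C: "subspace C" and cc: "complementary W C"
      and e: "proj_along W C \<in> Endo"
      using c Gr_complement_iff by auto
    let ?p = "proj_along W C"
    note p = proj_along_lin[OF W C cc] and pm = proj_along_mem[OF W C cc]
      and pi = proj_along_id[OF W C cc]
    define h where "h v = f (?p v) + (v - ?p v)" for v
    have "h \<in> Endo"
      unfolding h_def using Endo_add[OF Gr_hom_extend[OF f c] Endo_diff[OF Endo_id e]] .
    have ph: "?p (h v) = f (?p v)" for v
      unfolding h_def using Gr_hom_mem[OF f pm]
      by (simp add: lin_add[OF p] lin_diff[OF p] pi pm)
    have "inj h"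
    proof (rule injI)
      fix u v assume "h u = h v"
      then have "?p u = ?p v"
        using ph pm inj by (metis inj_onD)
      then show "u = v"
        using \<open>h u = h v\<close> by (simp add: h_def)
    qed
    then obtain g where g: "g \<in> Endo" "\<And>v. h (g v) = v" "\<And>v. g (h v) = v"
      using Endo_inverse[OF \<open>h \<in> Endo\<close>] by metis
    have hf: "h v = f v" if "v \<in> W" for v
      by (simp add: h_def pi that)
    \<comment> \<open>The \<open>W\<close>-part of \<open>h (g v) = v\<close> is
      \<open>f (?p (g v))\<close> and already equals \<open>v\<close>, so the part of
      \<open>g v\<close> in \<open>C\<close> vanishes.\<close>
    have gW: "g v \<in> W" if "v \<in> W" for v
    proof -
      have "f (?p (g v)) = v"
        using ph[of "g v"] by (simp add: g pi that)
      then have "g v = ?p (g v)"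
        using g(2)[of v] by (simp add: h_def)
      then show ?thesis
        using pm by metis
    qed
    have "restrict g W \<in> Hom W W"
      using restrict_Endo_Gr_hom[OF g(1) W] gW by blast
    moreover have "\<forall>v\<in>W. restrict g W (f v) = v"
      using hf g(3) Gr_hom_mem[OF f] by (metis restrict_apply)
    moreover have "\<forall>v\<in>W. f (restrict g W v) = v"
      using hf g(2) gW by (metis restrict_apply)
    ultimately show "f \<in> Gr_aut G r scale \<rho> W"
      unfolding Gr_aut_def using f by blast
  qed
qed

lemma Gr_aut_UNIV: "Gr_aut G r scale \<rho> UNIV = {f \<in> Endo. inj f}"
proof -
  have c: "complementary (UNIV :: 'v set) {0}"
    unfolding complementary_def by auto
  have "proj_along (UNIV :: 'v set) {0} = (\<lambda>v. v)"
    using proj_along_id[OF subspace_UNIV subspace_single_0 c] by (intro ext) simp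
  then have "Gr_complement G r scale \<rho> UNIV {0}"
    using Gr_complement_iff c subspace_UNIV subspace_single_0 Endo_id by simp
  from Gr_aut_eq[OF this] show ?thesis
    by (simp add: Gr_hom_UNIV)
qed

end

section \<open>Rigid decompositions and the five conditions\<close>

locale Gr_decomposition =
  rational_representation scale Basis G r \<rho>
  for scale :: "'k::alg_closed_field \<Rightarrow> 'v::ab_group_add \<Rightarrow> 'v" and Basis :: "'v set"
    and G :: "('g, 'k) alg_group" and r :: nat and \<rho> :: "'g \<Rightarrow> 'v \<Rightarrow> 'v" +
  fixes M N :: "'v set"
  assumes decomp: "Gr_complement G r scale \<rho> M N"
begin

abbreviation "p \<equiv> proj_along M N"
abbreviation "q \<equiv> proj_along N M"

text \<open>Lets each result about \<open>M\<close> be reinterpreted for \<open>N\<close>.\<close>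

lemma swap: "Gr_decomposition scale Basis G r \<rho> N M"
  by unfold_locales (use decomp Gr_complement_commute in blast)

lemma sub_M: "subspace M" and sub_N: "subspace N" and compl: "complementary M N"
  and p_Endo: "p \<in> Endo"
  using decomp Gr_complement_iff by auto

lemma compl': "complementary N M"
  using compl complementary_commute by blast

lemma q_Endo: "q \<in> Endo"
  using Gr_complement_iff decomp Gr_complement_commute by blast

lemmas p_lin = Endo_lin[OF p_Endo]
lemmas q_lin = Endo_lin[OF q_Endo]

lemma p_mem [simp]: "p v \<in> M" and q_mem [simp]: "q v \<in> N"
  using proj_along_mem sub_M sub_N compl compl' by blast+

lemma p_M [simp]: "v \<in> M \<Longrightarrow> p v = v" and q_N [simp]: "v \<in> N \<Longrightarrow> q v = v"
  and p_N [simp]: "v \<in> N \<Longrightarrow> p v = 0" and q_M [simp]: "v \<in> M \<Longrightarrow> q v = 0"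
  using proj_along_id proj_along_0 sub_M sub_N compl compl' by blast+

lemma p_plus_q: "p v + q v = v"
  using proj_along_swap[OF sub_M sub_N compl] by simp

lemma p_add: "p (u + v) = p u + p v" and q_add: "q (u + v) = q u + q v"
  using p_lin q_lin lin_add by blast+

lemma eq_by_proj: "p u = p v \<Longrightarrow> q u = q v \<Longrightarrow> u = v"
  using p_plus_q by metis

lemma Hom_M_Endo: "b \<in> Hom M W \<Longrightarrow> (\<lambda>v. b (p v)) \<in> Endo"
  using Gr_hom_extend decomp by blast

lemma Hom_N_Endo: "b \<in> Hom N W \<Longrightarrow> (\<lambda>v. b (q v)) \<in> Endo"
  using Gr_hom_extend decomp Gr_complement_commute by blast

lemma restrict_M_Hom: "h \<in> Endo \<Longrightarrow> (\<And>v. v \<in> M \<Longrightarrow> h v \<in> W) \<Longrightarrow> restrict h M \<in> Hom M W"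
  using restrict_Endo_Gr_hom sub_M by blast

lemma restrict_N_Hom: "h \<in> Endo \<Longrightarrow> (\<And>v. v \<in> N \<Longrightarrow> h v \<in> W) \<Longrightarrow> restrict h N \<in> Hom N W"
  using restrict_Endo_Gr_hom sub_N by blast

text \<open>The hub with which each of the five conditions is compared. It is phrased from the side
  of \<open>M\<close>, but \<open>rigid_swap\<close> makes it symmetric.\<close>

definition rigid :: bool where
  "rigid \<longleftrightarrow> (\<forall>b \<in> Hom M N. \<forall>c \<in> Hom N M. \<forall>m \<in> M. c (b m) = m \<longrightarrow> m = 0)"

lemma rigidD: "rigid \<Longrightarrow> b \<in> Hom M N \<Longrightarrow> c \<in> Hom N M \<Longrightarrow> m \<in> M \<Longrightarrow> c (b m) = m \<Longrightarrow> m = 0"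
  unfolding rigid_def by blast

text \<open>If \<open>b (c n) = n\<close>, then \<open>c n\<close> is a vector of \<open>M\<close>
  fixed by \<open>b\<close> followed by \<open>c\<close>.\<close>

lemma rigid_swap:
  assumes rigid
  shows "Gr_decomposition.rigid scale G r \<rho> N M"
proof -
  interpret s: Gr_decomposition scale Basis G r \<rho> N M
    by (rule swap)
  show ?thesis
    unfolding s.rigid_def
  proof (intro ballI impI)
    fix c b n assume c: "c \<in> Hom N M" and b: "b \<in> Hom M N" and n: "n \<in> N" "b (c n) = n"
    then have "c n = 0"
      using rigidD[OF assms b c] Gr_hom_mem[OF c] by simp
    then show "n = 0"
      using n(2) Gr_hom_0[OF b sub_M] by simp
  qed
qed

lemma rigid_imp_nilpotent:
  assumes rigid "b \<in> Hom M N" "c \<in> Hom N M"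
  shows "nilpotent_map (off_diagonal M N b c)"
proof (rule nilpotent_if_no_eigenvector)
  have off: "off_diagonal M N b c = (\<lambda>v. b (p v) + c (q v))"
    unfolding off_diagonal_def by (rule refl)
  show "lin (off_diagonal M N b c)"
    unfolding off by (intro Endo_lin Endo_add Hom_M_Endo[OF assms(2)] Hom_N_Endo[OF assms(3)])
  show "finite_dimensional_vector_space scale Basis" ..
  fix a v assume a: "a \<noteq> 0" and ev: "off_diagonal M N b c v = scale a v"
  have bN: "b (p v) \<in> N" and cM: "c (q v) \<in> M"
    using assms Gr_hom_mem by auto
  have pv: "scale a (p v) = c (q v)"
    using arg_cong[OF ev, of p] bN cM by (simp add: off p_add lin_scale[OF p_lin])
  have qv: "scale a (q v) = b (p v)"
    using arg_cong[OF ev, of q] bN cM by (simp add: off q_add lin_scale[OF q_lin])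
  \<comment> \<open>The eigenvalue equations give that \<open>b\<close> followed by \<open>c\<close>
    multiplies \<open>p v\<close> by \<open>a * a\<close>; dividing \<open>b\<close> by this factor
    makes \<open>p v\<close> a fixed vector.\<close>
  let ?b = "restrict (\<lambda>v. scale (inverse (a * a)) (b (p v))) M"
  have "?b \<in> Hom M N"
    using Gr_hom_mem[OF assms(2)] subspace_scale[OF sub_N]
    by (intro restrict_M_Hom Endo_scale Hom_M_Endo[OF assms(2)]) auto
  moreover have "c (?b (p v)) = p v"
  proof -
    have "c (?b (p v)) = scale (inverse (a * a) * a) (c (q v))"
      using Gr_hom_scale[OF assms(3)] by (simp add: qv[symmetric])
    also have "\<dots> = scale (inverse (a * a) * a * a) (p v)"
      by (simp add: pv[symmetric])
    also have "inverse (a * a) * a * a = 1"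
      using a by (simp add: field_simps)
    finally show ?thesis
      by simp
  qed
  ultimately have "p v = 0"
    using rigidD assms(1,3) by simp
  moreover from this have "q v = 0"
    using qv a Gr_hom_0[OF assms(2) sub_M] by simp
  ultimately show "v = 0"
    using p_plus_q[of v] by simp
qed

text \<open>If \<open>c (b m) = m\<close>, the off-diagonal endomorphism fixes
  \<open>m + b m\<close>, and a nilpotent map has no nonzero fixed vector.\<close>

lemma nilpotent_imp_rigid:
  assumes "\<forall>b \<in> Hom M N. \<forall>c \<in> Hom N M. nilpotent_map (off_diagonal M N b c)"
  shows rigid
  unfolding rigid_def
proof (intro ballI impI)
  fix b c m assume b: "b \<in> Hom M N" and c: "c \<in> Hom N M" and m: "m \<in> M" "c (b m) = m"
  let ?T = "off_diagonal M N b c" and ?v = "m + b m"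
  have bN: "b m \<in> N"
    using Gr_hom_mem[OF b m(1)] .
  have "?T ?v = ?v"
    using m bN by (simp add: off_diagonal_def p_add q_add add.commute)
  then have "(?T ^^ n) ?v = ?v" for n
    by (induction n) auto
  then have "?v = 0"
    using assms b c unfolding nilpotent_map_def by metis
  then have "p ?v = 0"
    by (simp add: lin_0[OF p_lin])
  then show "m = 0"
    using m bN by (simp add: p_add)
qed

lemma image_in_summands:
  assumes "f \<in> Endo" "inj f"
  shows "f ` M \<in> summands G r scale \<rho> M"
  using Gr_complement_image[OF assms decomp] unfolding summands_def by blast

lemma complements_imp_rigid:
  assumes "\<forall>M' \<in> summands G r scale \<rho> M. Gr_complement G r scale \<rho> M' N"
  shows rigid
  unfolding rigid_def
proof (intro ballI impI)
  fix b c m assume b: "b \<in> Hom M N" and c: "c \<in> Hom N M" and m: "m \<in> M" "c (b m) = m"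
  define \<beta> where "\<beta> v = v + b (p v)" for v
  define \<gamma> where "\<gamma> v = v - c (q v)" for v
  have \<beta>: "\<beta> \<in> Endo" and \<gamma>: "\<gamma> \<in> Endo"
    unfolding \<beta>_def \<gamma>_def
    using Endo_add[OF Endo_id Hom_M_Endo[OF b]] Endo_diff[OF Endo_id Hom_N_Endo[OF c]] .
  \<comment> \<open>\<open>\<beta>\<close> keeps the \<open>M\<close>-component and changes the
    vector by something depending on that component alone; \<open>\<gamma>\<close> does the same
    with \<open>N\<close>. Hence both are injective.\<close>
  have "p (\<beta> v) = p v" for v
    using Gr_hom_mem[OF b] by (simp add: \<beta>_def p_add)
  then have "inj \<beta>"
    by (intro injI) (metis \<beta>_def add_right_cancel)
  have "q (\<gamma> v) = q v" for v
    using Gr_hom_mem[OF c] by (simp add: \<gamma>_def lin_diff[OF q_lin])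
  then have "inj \<gamma>"
    by (intro injI) (metis \<gamma>_def diff_add_cancel)
  have inj: "inj (\<lambda>v. \<gamma> (\<beta> v))"
    using inj_compose[OF \<open>inj \<gamma>\<close> \<open>inj \<beta>\<close>] by (simp add: comp_def)
  have "\<gamma> (\<beta> m) = b m"
    using m Gr_hom_mem[OF b] by (simp add: \<beta>_def \<gamma>_def q_add)
  then have "\<gamma> (\<beta> m) \<in> (\<lambda>v. \<gamma> (\<beta> v)) ` M \<inter> N"
    using imageI[OF m(1), of "\<lambda>v. \<gamma> (\<beta> v)"] Gr_hom_mem[OF b m(1)] by simp
  moreover have "Gr_complement G r scale \<rho> ((\<lambda>v. \<gamma> (\<beta> v)) ` M) N"
    by (rule bspec[OF assms image_in_summands[OF Endo_comp[OF \<gamma> \<beta>] inj]])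
  ultimately have "\<gamma> (\<beta> m) = 0"
    unfolding Gr_complement_def complementary_def by simp
  moreover have "\<gamma> (\<beta> 0) = 0"
    using lin_0[OF Endo_lin[OF Endo_comp[OF \<gamma> \<beta>]]] .
  ultimately show "m = 0"
    using injD[OF inj, of m 0] by simp
qed

lemma summands_dim: "M' \<in> summands G r scale \<rho> M \<Longrightarrow> dim M' = dim M"
  unfolding summands_def using Gr_isomorphic_dim by blast

lemma summand_subspace: "M' \<in> summands G r scale \<rho> M \<Longrightarrow> subspace M'"
  unfolding summands_def using Gr_complement_iff by blast

lemma rigid_imp_complements:
  assumes rigid and M': "M' \<in> summands G r scale \<rho> M"
  shows "Gr_complement G r scale \<rho> M' N"
proof -
  obtain C where C: "Gr_complement G r scale \<rho> M' C"
    using M' unfolding summands_def by blast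
  obtain f g where fg: "f \<in> Hom M' M" "g \<in> Hom M M'" "\<And>v. v \<in> M' \<Longrightarrow> g (f v) = v"
    using M' unfolding summands_def Gr_isomorphic_def by blast
  have sub: "subspace M'" "subspace C" "complementary M' C"
    using C Gr_complement_iff by auto
  \<comment> \<open>For \<open>v\<close> in both \<open>M'\<close> and \<open>N\<close>, the vector
    \<open>f v\<close> returns to \<open>v\<close> under \<open>g\<close>, \<open>v\<close> is fixed
    by \<open>q\<close> and by the projection to \<open>M'\<close>, and \<open>f\<close> maps it to
    \<open>f v\<close> again. So \<open>f v\<close> is fixed by \<open>?b\<close> followed by
    \<open>?c\<close>.\<close>
  let ?b = "restrict (\<lambda>v. q (g (p v))) M"
  let ?c = "restrict (\<lambda>v. f (proj_along M' C v)) N"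
  have b: "?b \<in> Hom M N"
    by (intro restrict_M_Hom Endo_comp[OF q_Endo] Hom_M_Endo[OF fg(2)]) simp
  have c: "?c \<in> Hom N M"
    using proj_along_mem[OF sub] Gr_hom_mem[OF fg(1)]
    by (intro restrict_N_Hom Gr_hom_extend[OF fg(1) C]) simp
  have "v = 0" if "v \<in> M'" "v \<in> N" for v
  proof -
    have m: "f v \<in> M"
      using Gr_hom_mem[OF fg(1)] that by blast
    have "?c (?b (f v)) = f v"
      using that m by (simp add: fg proj_along_id[OF sub])
    then have "f v = 0"
      using rigidD[OF \<open>rigid\<close> b c m] by simp
    then show ?thesis
      using fg(3)[OF that(1)] Gr_hom_0[OF fg(2) sub_M] by simp
  qed
  then have "M' \<inter> N = {0}"
    using subspace_0[OF sub(1)] subspace_0[OF sub_N] by blast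
  then have "complementary M' N"
    using complementary_of_dim[OF compl sub_M sub_N sub(1)] summands_dim[OF M'] by simp
  then show ?thesis
    using C decomp unfolding Gr_complement_def by blast
qed

text \<open>Presents a complement \<open>M'\<close> of \<open>N\<close> as a graph over
  \<open>M\<close>: since \<open>v\<close> and \<open>p v\<close> differ by a vector of
  \<open>N\<close>, projecting to \<open>M'\<close> along \<open>N\<close> inverts \<open>p\<close>
  on \<open>M'\<close>.\<close>

lemma summand_hom:
  assumes "Gr_complement G r scale \<rho> M' N"
  shows "(\<lambda>m\<in>M. q (proj_along M' N m)) \<in> Hom M N"
    and "v \<in> M' \<Longrightarrow> proj_along M' N (p v) = v"
proof -
  have sub: "subspace M'" "subspace N" "complementary M' N" "proj_along M' N \<in> Endo"
    using assms Gr_complement_iff by auto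
  show "(\<lambda>m\<in>M. q (proj_along M' N m)) \<in> Hom M N"
    by (intro restrict_M_Hom Endo_comp[OF q_Endo sub(4)]) simp
  have "p v - v = - q v"
    by (metis add_diff_cancel_left' minus_diff_eq p_plus_q)
  then show "v \<in> M' \<Longrightarrow> proj_along M' N (p v) = v"
    using proj_along_unique[OF sub(1-3), of v "p v"] subspace_neg[OF sub_N q_mem] by simp
qed

text \<open>Both summands are graphs, one over \<open>M\<close> and one over \<open>N\<close>. A
  common vector \<open>v\<close> satisfies \<open>?b (p v) = q v\<close> and
  \<open>?c (q v) = p v\<close>, which rigidity allows only for \<open>v = 0\<close>.\<close>

lemma rigid_imp_all_complements:
  assumes rigid and M': "M' \<in> summands G r scale \<rho> M" and N': "N' \<in> summands G r scale \<rho> N"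
  shows "Gr_complement G r scale \<rho> M' N'"
proof -
  interpret s: Gr_decomposition scale Basis G r \<rho> N M
    by (rule swap)
  have M'N: "Gr_complement G r scale \<rho> M' N"
    using rigid_imp_complements[OF assms(1) M'] .
  have N'M: "Gr_complement G r scale \<rho> N' M"
    using s.rigid_imp_complements[OF rigid_swap[OF assms(1)] N'] .
  have sub: "subspace M'" "subspace N'" "complementary N M'"
    using M'N N'M Gr_complement_iff complementary_commute by auto
  let ?b = "\<lambda>m\<in>M. q (proj_along M' N m)" and ?c = "\<lambda>n\<in>N. p (proj_along N' M n)"
  have "v = 0" if "v \<in> M'" "v \<in> N'" for v
  proof -
    have 1: "?b (p v) = q v" and 2: "?c (q v) = p v"
      using summand_hom(2)[OF M'N that(1)] s.summand_hom(2)[OF N'M that(2)] by simp_all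
    have "p v = 0"
      by (rule rigidD[OF assms(1) summand_hom(1)[OF M'N] s.summand_hom(1)[OF N'M]])
        (simp_all only: 1 2 p_mem)
    moreover from this have "q v = 0"
      using 1 Gr_hom_0[OF summand_hom(1)[OF M'N] sub_M] by metis
    ultimately show ?thesis
      using p_plus_q[of v] by simp
  qed
  then have "N' \<inter> M' = {0}"
    using subspace_0[OF sub(1)] subspace_0[OF sub(2)] by blast
  then have "complementary N' M'"
    using complementary_of_dim[OF sub(3) sub_N sub(1,2)] s.summands_dim[OF N'] by simp
  then show ?thesis
    using M'N N'M complementary_commute unfolding Gr_complement_def by blast
qed

text \<open>If the diagonal block kills \<open>m\<close>, then \<open>X m\<close> lies in
  \<open>N\<close>, and the off-diagonal blocks of \<open>X\<close> and of its inverse carry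
  \<open>m\<close> to \<open>X m\<close> and back.\<close>

lemma rigid_imp_diagonal_inj:
  assumes rigid and X: "X \<in> Endo" "inj X"
  shows "inj_on (\<lambda>m\<in>M. p (X m)) M"
proof (rule inj_onI)
  fix u v assume uv: "u \<in> M" "v \<in> M" "(\<lambda>m\<in>M. p (X m)) u = (\<lambda>m\<in>M. p (X m)) v"
  obtain Y where Y: "Y \<in> Endo" "\<And>v. Y (X v) = v"
    using Endo_inverse[OF X] by metis
  let ?b = "\<lambda>m\<in>M. q (X m)" and ?c = "\<lambda>n\<in>N. p (Y n)" and ?m = "u - v"
  have m: "?m \<in> M"
    using uv subspace_diff[OF sub_M] by blast
  have "p (X ?m) = 0"
    using uv by (simp add: lin_diff[OF Endo_lin[OF X(1)]] lin_diff[OF p_lin])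
  then have "q (X ?m) = X ?m"
    using p_plus_q[of "X ?m"] by simp
  then have "?c (?b ?m) = ?m"
    using m q_mem[of "X ?m"] by (simp add: Y)
  moreover have "?b \<in> Hom M N" "?c \<in> Hom N M"
    using X Y by (auto intro!: restrict_M_Hom restrict_N_Hom Endo_comp[OF p_Endo] Endo_comp[OF q_Endo])
  ultimately have "?m = 0"
    using rigidD[OF assms(1)] m by blast
  then show "u = v"
    by simp
qed

lemma rigid_imp_blocks_bij:
  assumes rigid
  shows "bij_betw (blocks M N) (Gr_aut G r scale \<rho> UNIV)
    (Gr_aut G r scale \<rho> M \<times> Hom M N \<times> Hom N M \<times> Gr_aut G r scale \<rho> N)"
proof -
  interpret s: Gr_decomposition scale Basis G r \<rho> N M
    by (rule swap)
  note aut = Gr_aut_UNIV Gr_aut_eq[OF decomp] Gr_aut_eq[OF s.decomp]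
  have "inj_on (blocks M N) (Gr_aut G r scale \<rho> UNIV)"
  proof (rule inj_onI)
    fix X Y assume "X \<in> Gr_aut G r scale \<rho> UNIV" "Y \<in> Gr_aut G r scale \<rho> UNIV"
      and eq: "blocks M N X = blocks M N Y"
    then have X: "X \<in> Endo" and Y: "Y \<in> Endo"
      by (auto simp: aut)
    note e = eq[unfolded blocks_def prod.inject]
    have "X m = Y m" if "m \<in> M" for m
      by (rule eq_by_proj) (use that fun_cong[OF e[THEN conjunct1], of m]
          fun_cong[OF e[THEN conjunct2, THEN conjunct1], of m] in simp_all)
    moreover have "X n = Y n" if "n \<in> N" for n
      by (rule eq_by_proj) (use that fun_cong[OF e[THEN conjunct2, THEN conjunct2, THEN conjunct1], of n]
          fun_cong[OF e[THEN conjunct2, THEN conjunct2, THEN conjunct2], of n] in simp_all)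
    ultimately have "X (p v) + X (q v) = Y (p v) + Y (q v)" for v
      by simp
    then show "X = Y"
      by (intro ext) (simp add: lin_add[OF Endo_lin[OF X], symmetric]
          lin_add[OF Endo_lin[OF Y], symmetric] p_plus_q)
  qed
  moreover have "blocks M N X \<in> Gr_aut G r scale \<rho> M \<times> Hom M N \<times> Hom N M \<times> Gr_aut G r scale \<rho> N"
    if "X \<in> Gr_aut G r scale \<rho> UNIV" for X
  proof -
    have X: "X \<in> Endo" "inj X"
      using that by (auto simp: aut)
    show ?thesis
      using rigid_imp_diagonal_inj[OF assms X] s.rigid_imp_diagonal_inj[OF rigid_swap[OF assms] X] X(1)
      by (auto simp: blocks_def aut intro!: restrict_M_Hom restrict_N_Hom Endo_comp[OF p_Endo] Endo_comp[OF q_Endo])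
  qed
  moreover have "t \<in> blocks M N ` Gr_aut G r scale \<rho> UNIV"
    if t: "t \<in> Gr_aut G r scale \<rho> M \<times> Hom M N \<times> Hom N M \<times> Gr_aut G r scale \<rho> N" for t
  proof -
    obtain \<alpha> b c \<delta> where abcd: "t = (\<alpha>, b, c, \<delta>)" and "\<alpha> \<in> Gr_aut G r scale \<rho> M"
      and b: "b \<in> Hom M N" and c: "c \<in> Hom N M" and "\<delta> \<in> Gr_aut G r scale \<rho> N"
      using t by blast
    then obtain \<alpha>' \<delta>' where \<alpha>: "\<alpha> \<in> Hom M M" "\<alpha>' \<in> Hom M M" "\<And>v. v \<in> M \<Longrightarrow> \<alpha>' (\<alpha> v) = v"
      and \<delta>: "\<delta> \<in> Hom N N" "\<delta>' \<in> Hom N N" "\<And>v. v \<in> N \<Longrightarrow> \<delta>' (\<delta> v) = v"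
      unfolding Gr_aut_def by blast
    have mem [simp]: "v \<in> M \<Longrightarrow> \<alpha> v \<in> M" "v \<in> M \<Longrightarrow> b v \<in> N" "v \<in> N \<Longrightarrow> c v \<in> M"
      "v \<in> N \<Longrightarrow> \<delta> v \<in> N" for v
      using \<alpha>(1) b c \<delta>(1) Gr_hom_mem by blast+
    have zero [simp]: "\<alpha> 0 = 0" "b 0 = 0" "c 0 = 0" "\<delta> 0 = 0"
      using Gr_hom_0 \<alpha>(1) b c \<delta>(1) sub_M sub_N by blast+
    define X where "X v = (\<alpha> (p v) + c (q v)) + (b (p v) + \<delta> (q v))" for v
    have X: "X \<in> Endo"
      unfolding X_def using \<alpha>(1) b c \<delta>(1) by (intro Endo_add Hom_M_Endo Hom_N_Endo)
    have pX: "p (X v) = \<alpha> (p v) + c (q v)" and qX: "q (X v) = b (p v) + \<delta> (q v)" for v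
      by (simp_all add: X_def p_add q_add)
    have "inj X"
    proof (rule injI)
      fix u v assume "X u = X v"
      define w where "w = u - v"
      have "X w = 0"
        using \<open>X u = X v\<close> by (simp add: w_def lin_diff[OF Endo_lin[OF X]])
      then have 1: "\<alpha> (p w) = - c (q w)" and 2: "\<delta> (q w) = - b (p w)"
        using pX[of w] qX[of w]
        by (simp_all add: lin_0[OF p_lin] lin_0[OF q_lin] eq_neg_iff_add_eq_0 add.commute)
      \<comment> \<open>Solving the two block equations with the inverses of the diagonal blocks
        gives \<open>q w = ?b (p w)\<close> and \<open>p w = ?c (q w)\<close>. The inner
        \<open>p\<close> and \<open>q\<close> change no values; they display the maps as composites
        in \<open>Endo\<close>.\<close>
      let ?b = "\<lambda>m\<in>M. - \<delta>' (q (b (p m)))" and ?c = "\<lambda>n\<in>N. - \<alpha>' (p (c (q n)))"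
      have "(\<lambda>v. - \<delta>' (q (b (p v)))) \<in> Endo" "(\<lambda>v. - \<alpha>' (p (c (q v)))) \<in> Endo"
        using Endo_scale[OF Endo_comp[OF Hom_N_Endo[OF \<delta>(2)] Hom_M_Endo[OF b]], of "-1"]
          Endo_scale[OF Endo_comp[OF Hom_M_Endo[OF \<alpha>(2)] Hom_N_Endo[OF c]], of "-1"] by simp_all
      then have b': "?b \<in> Hom M N" and c': "?c \<in> Hom N M"
        using Gr_hom_mem[OF \<alpha>(2)] Gr_hom_mem[OF \<delta>(2)]
        by (auto intro!: restrict_M_Hom restrict_N_Hom subspace_neg sub_M sub_N)
      have "?b (p w) = q w"
        using \<delta>(3)[of "q w"] Gr_hom_minus[OF \<delta>(2)] by (simp add: 2)
      moreover have "?c (q w) = p w"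
        using \<alpha>(3)[of "p w"] Gr_hom_minus[OF \<alpha>(2)] by (simp add: 1)
      ultimately have "p w = 0"
        using rigidD[OF assms b' c', of "p w"] by simp
      moreover from this have "q w = 0"
        using 2 \<delta>(3)[of "q w"] Gr_hom_0[OF \<delta>(2) sub_N] by simp
      ultimately show "u = v"
        using p_plus_q[of w] by (simp add: w_def)
    qed
    have "blocks M N X = t"
      unfolding abcd blocks_def pX qX
      using Gr_hom_extensional[OF \<alpha>(1)] Gr_hom_extensional[OF b] Gr_hom_extensional[OF c]
        Gr_hom_extensional[OF \<delta>(1)]
      by (auto simp: fun_eq_iff extensional_def)
    then show ?thesis
      using X \<open>inj X\<close> by (auto simp: aut)
  qed
  ultimately show ?thesis
    unfolding bij_betw_def by blast
qed

text \<open>Surjectivity yields an automorphism with identity diagonal blocks and off-diagonal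
  blocks \<open>- b\<close> and \<open>- c\<close>. If \<open>c (b m) = m\<close>, it kills
  \<open>m + b m\<close>.\<close>

lemma blocks_bij_imp_rigid:
  assumes "bij_betw (blocks M N) (Gr_aut G r scale \<rho> UNIV)
    (Gr_aut G r scale \<rho> M \<times> Hom M N \<times> Hom N M \<times> Gr_aut G r scale \<rho> N)"
  shows rigid
  unfolding rigid_def
proof (intro ballI impI)
  fix b c m assume b: "b \<in> Hom M N" and c: "c \<in> Hom N M" and m: "m \<in> M" "c (b m) = m"
  have id: "(\<lambda>v\<in>M. v) \<in> Gr_aut G r scale \<rho> M" "(\<lambda>v\<in>N. v) \<in> Gr_aut G r scale \<rho> N"
    using Gr_aut_eq[OF decomp] Gr_aut_eq[OF decomp[THEN Gr_complement_commute[THEN iffD1]]]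
      restrict_M_Hom[OF Endo_id] restrict_N_Hom[OF Endo_id] by auto
  have neg: "(\<lambda>v\<in>M. - b (p v)) \<in> Hom M N" "(\<lambda>v\<in>N. - c (q v)) \<in> Hom N M"
    using Endo_scale[OF Hom_M_Endo[OF b], of "-1"] Endo_scale[OF Hom_N_Endo[OF c], of "-1"]
      Gr_hom_mem[OF b] Gr_hom_mem[OF c]
    by (auto intro!: restrict_M_Hom restrict_N_Hom subspace_neg sub_M sub_N)
  have "(\<lambda>v\<in>M. v, \<lambda>v\<in>M. - b (p v), \<lambda>v\<in>N. - c (q v), \<lambda>v\<in>N. v)
      \<in> blocks M N ` Gr_aut G r scale \<rho> UNIV"
    unfolding bij_betw_imp_surj_on[OF assms] using id neg by (intro SigmaI)
  then obtain X where X: "X \<in> Gr_aut G r scale \<rho> UNIV"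
    and bl: "blocks M N X = (\<lambda>v\<in>M. v, \<lambda>v\<in>M. - b (p v), \<lambda>v\<in>N. - c (q v), \<lambda>v\<in>N. v)"
    by (auto simp del: Product_Type.prod.inject)
  note e = bl[unfolded blocks_def prod.inject]
  have XE: "X \<in> Endo" "inj X"
    using X Gr_aut_UNIV by auto
  have n: "b m \<in> N"
    using Gr_hom_mem[OF b m(1)] .
  have "p (X m) = m" "q (X m) = - b m"
    using m fun_cong[OF e[THEN conjunct1], of m]
      fun_cong[OF e[THEN conjunct2, THEN conjunct1], of m] by simp_all
  moreover have "p (X (b m)) = - m" "q (X (b m)) = b m"
    using m n fun_cong[OF e[THEN conjunct2, THEN conjunct2, THEN conjunct1], of "b m"]
      fun_cong[OF e[THEN conjunct2, THEN conjunct2, THEN conjunct2], of "b m"] by simp_all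
  ultimately have "X (m + b m) = X 0"
    by - (rule eq_by_proj,
      simp_all add: lin_add[OF Endo_lin[OF XE(1)]] lin_0[OF Endo_lin[OF XE(1)]] p_add q_add
        lin_0[OF p_lin] lin_0[OF q_lin])
  then have "m + b m = 0"
    using XE(2) injD by metis
  then have "p (m + b m) = 0"
    by (simp add: lin_0[OF p_lin])
  then show "m = 0"
    using m n by (simp add: p_add)
qed

end

section \<open>Pluecker forms\<close>

text \<open>Members of \<open>fun_algebra\<close> are restricted functions. This and the following
  closure rules keep \<open>restrict\<close> outermost, so that they iterate through sums, products
  and determinants.\<close>

lemma restrict_fun_algebra_add:
  "restrict f X \<in> fun_algebra X B \<Longrightarrow> restrict g X \<in> fun_algebra X B
    \<Longrightarrow> (\<lambda>x\<in>X. f x + g x) \<in> fun_algebra X B"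
  using fun_algebra.add[of "restrict f X" X B "restrict g X"]
  by (simp cong: restrict_cong)

lemma restrict_fun_algebra_mult:
  "restrict f X \<in> fun_algebra X B \<Longrightarrow> restrict g X \<in> fun_algebra X B
    \<Longrightarrow> (\<lambda>x\<in>X. f x * g x) \<in> fun_algebra X B"
  using fun_algebra.mult[of "restrict f X" X B "restrict g X"]
  by (simp cong: restrict_cong)

lemma restrict_fun_algebra_sum:
  "(\<And>i. i \<in> I \<Longrightarrow> restrict (f i) X \<in> fun_algebra X B)
    \<Longrightarrow> (\<lambda>x\<in>X. \<Sum>i\<in>I. f i x) \<in> fun_algebra X B"
  by (induction I rule: infinite_finite_induct)
    (auto simp: fun_algebra.const restrict_fun_algebra_add)

lemma restrict_fun_algebra_prod:
  "(\<And>i. i \<in> I \<Longrightarrow> restrict (f i) X \<in> fun_algebra X B)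
    \<Longrightarrow> (\<lambda>x\<in>X. \<Prod>i\<in>I. f i x) \<in> fun_algebra X B"
  by (induction I rule: infinite_finite_induct)
    (auto simp: fun_algebra.const restrict_fun_algebra_mult)

lemma restrict_fun_algebra_det:
  assumes "\<And>i j. i < m \<Longrightarrow> j < m \<Longrightarrow> restrict (a i j) X \<in> fun_algebra X B"
  shows "(\<lambda>x\<in>X. det (mat m m (\<lambda>(i, j). a i j x))) \<in> fun_algebra X B"
proof -
  have "det (mat m m (\<lambda>(i, j). a i j x))
      = (\<Sum>\<pi> \<in> {\<pi>. \<pi> permutes {0..<m}}. signof \<pi> * (\<Prod>i = 0..<m. a i (\<pi> i) x))" for x
    by (subst det_def'[of _ m])
      (auto intro!: sum.cong prod.cong simp: permutes_in_image[of _ "{0..<m}", simplified])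
  moreover have "(\<lambda>x\<in>X. \<Sum>\<pi> \<in> {\<pi>. \<pi> permutes {0..<m}}.
      signof \<pi> * (\<Prod>i = 0..<m. a i (\<pi> i) x)) \<in> fun_algebra X B"
    using assms permutes_in_image[of _ "{0..<m}"]
    by (intro restrict_fun_algebra_sum restrict_fun_algebra_mult fun_algebra.const
        restrict_fun_algebra_prod) auto
  ultimately show ?thesis
    by simp
qed

text \<open>Cramer's rule for the identity matrix: the transpose is the identity with column
  \<open>k\<close> replaced by \<open>x\<close>.\<close>

lemma det_unit_with_row:
  fixes x :: "nat \<Rightarrow> 'a::field"
  assumes "k < m"
  shows "det (mat m m (\<lambda>(i, j). if i = k then x j else if i = j then 1 else 0)) = x k"
proof -
  let ?A = "mat m m (\<lambda>(i, j). if i = k then x j else if i = j then 1 else 0)"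
  have "det ?A = det (transpose_mat ?A)"
    by (rule det_transpose[symmetric]) auto
  also have "transpose_mat ?A = replace_col (1\<^sub>m m) (1\<^sub>m m *\<^sub>v vec m x) k"
    by (rule eq_matI) (auto simp: replace_col_def)
  also have "det \<dots> = x k"
    using assms by (subst cramer_lemma_mat[of _ m]) auto
  finally show ?thesis .
qed

lemma affine_fun_space_basic_open:
  "f \<in> A \<Longrightarrow> openin (zariski (affine_fun_space X A)) {x \<in> X. f x \<noteq> 0}"
  unfolding affine_fun_space_def Let_def by (auto intro: topology_generated_by_Basis)

lemma affine_fun_space_points:
  fixes A :: "('a \<Rightarrow> 'k::field) set"
  assumes "(\<lambda>x\<in>X. 1) \<in> A"
  shows "points (affine_fun_space X A) = X"
proof -
  have "x \<in> \<Union> {{x \<in> X. f x \<noteq> 0} | f. f \<in> A}" if "x \<in> X" for x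
  proof
    show "{x \<in> X. (\<lambda>x\<in>X. 1 :: 'k) x \<noteq> 0} \<in> {{x \<in> X. f x \<noteq> 0} | f. f \<in> A}"
      using assms by blast
    show "x \<in> {x \<in> X. (\<lambda>x\<in>X. 1 :: 'k) x \<noteq> 0}"
      using that by simp
  qed
  then show ?thesis
    unfolding affine_fun_space_def Let_def by auto
qed

lemma pluecker_form_cmult:
  "pluecker_form scale m d P \<Longrightarrow> pluecker_form scale m d (\<lambda>w. c * P w)"
proof (induction rule: pluecker_form.induct)
  case (const c')
  show ?case
    using pluecker_form.const[of scale m "c * c'"] .
next
  case (add d P Q)
  then show ?case
    using pluecker_form.add[OF add.IH] by (simp add: distrib_left)
next
  case (mult l d P)
  then show ?case
    using pluecker_form.mult[OF mult(1) mult.IH] by (simp add: ac_simps)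
qed

lemma pluecker_form_mult:
  "pluecker_form scale m d P \<Longrightarrow> pluecker_form scale m e Q
    \<Longrightarrow> pluecker_form scale m (d + e) (\<lambda>w. P w * Q w)"
proof (induction rule: pluecker_form.induct)
  case (const c)
  then show ?case
    using pluecker_form_cmult by simp
next
  case (add d P Q)
  then show ?case
    using pluecker_form.add[of scale m] by (simp add: distrib_right)
next
  case (mult l d P)
  then show ?case
    using pluecker_form.mult[OF mult(1)] by (simp add: mult.assoc)
qed

lemma pluecker_form_power:
  "pluecker_form scale m 1 P \<Longrightarrow> pluecker_form scale m n (\<lambda>w. P w ^ n)"
proof (induction n)
  case 0
  show ?case
    using pluecker_form.const[of scale m 1] by simp
next
  case (Suc n)
  then show ?case
    using pluecker_form_mult[of scale m 1 P n] by simp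
qed

lemma pluecker_form_det:
  assumes "\<And>i. i < m \<Longrightarrow> Vector_Spaces.linear scale (*) (l i)"
  shows "pluecker_form scale m 1 (\<lambda>w. det (mat m m (\<lambda>(i, j). l i (w j))))"
  using pluecker_form.mult[of m scale l 0 "\<lambda>w. 1"] pluecker_form.const[of scale m 1] assms by simp

section \<open>Frames and regular functions on the Grassmannian\<close>

context finite_dimensional_vector_space
begin

lemma frame_mem: "frame scale m W w \<Longrightarrow> j < m \<Longrightarrow> w j \<in> W"
  unfolding frame_def by (auto intro: span_base)

lemma frame_dim:
  assumes "frame scale m W w"
  shows "subspace W" "dim W = m"
  using assms subspace_span[of "w ` {..<m}"] dim_span_eq_card_independent[of "w ` {..<m}"] card_image[of w "{..<m}"]
  unfolding frame_def by auto

lemma frame_exists: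
  assumes "subspace W" "dim W = m"
  obtains w where "frame scale m W w"
proof -
  obtain B where B: "finite B" "independent B" "span B = W" "card B = m"
    using basis_subspace_exists[OF assms(1)] assms(2) by metis
  then obtain w where w: "bij_betw w {..<m} B"
    using ex_bij_betw_nat_finite[OF B(1)] by (auto simp: atLeast0LessThan)
  then have "frame scale m W w"
    using B unfolding frame_def bij_betw_def by simp
  then show ?thesis
    by (rule that)
qed

lemma frame_image:
  assumes f: "lin f" and inj: "inj f" and w: "frame scale m W w"
  shows "frame scale m (f ` W) (\<lambda>j. f (w j))"
proof -
  interpret f: Vector_Spaces.linear scale scale f
    by (rule f)
  have im: "(\<lambda>j. f (w j)) ` {..<m} = f ` w ` {..<m}"
    by auto
  have "inj_on (\<lambda>j. f (w j)) {..<m}"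
    using w inj unfolding frame_def inj_on_def by blast
  then show ?thesis
    using w inj f.independent_injective_image[of "w ` {..<m}"] f.span_image[of "w ` {..<m}"]
    unfolding frame_def im by (simp add: inj_on_subset)
qed

lemma frame_change:
  assumes w: "frame scale m W w" and w': "\<And>j. j < m \<Longrightarrow> w' j \<in> W"
  obtains a where "\<And>j. j < m \<Longrightarrow> w' j = (\<Sum>i<m. scale (a i j) (w i))"
proof -
  have inj: "inj_on w {..<m}" and sp: "span (w ` {..<m}) = W"
    using w unfolding frame_def by auto
  have "\<exists>u. w' j = (\<Sum>i<m. scale (u i) (w i))" if "j < m" for j
  proof -
    have "w' j \<in> range (\<lambda>u. \<Sum>v\<in>w ` {..<m}. scale (u v) v)"
      using w'[OF that] sp span_finite[of "w ` {..<m}"] by simp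
    then obtain u where "w' j = (\<Sum>v\<in>w ` {..<m}. scale (u v) v)"
      by blast
    then have "w' j = (\<Sum>i<m. scale (u (w i)) (w i))"
      by (simp add: sum.reindex[OF inj])
    then show ?thesis
      by (rule exI[of _ "\<lambda>i. u (w i)"])
  qed
  then obtain u where "\<And>j. j < m \<Longrightarrow> w' j = (\<Sum>i<m. scale (u j i) (w i))"
    by metis
  then show ?thesis
    using that[of "\<lambda>i j. u j i"] by blast
qed

text \<open>Each Pluecker coordinate is multiplied by the determinant \<open>c\<close> of the base
  change, a form of degree \<open>d\<close> by its \<open>d\<close>-th power. Since \<open>c\<close>
  serves all forms at once, quotients of forms of equal degree depend only on the subspace.\<close>

lemma pluecker_form_frame_change:
  assumes w: "frame scale m W w" and w': "frame scale m W w'"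
  obtains c where "\<And>d P. pluecker_form scale m d P \<Longrightarrow> P w' = c ^ d * P w"
proof -
  obtain a where a: "\<And>j. j < m \<Longrightarrow> w' j = (\<Sum>i<m. scale (a i j) (w i))"
    using frame_change[OF w] frame_mem[OF w'] by metis
  let ?A = "mat m m (\<lambda>(i, j). a i j)"
  have "P w' = det ?A ^ d * P w" if "pluecker_form scale m d P" for d P
    using that
  proof (induction rule: pluecker_form.induct)
    case (const c)
    show ?case
      by simp
  next
    case (add d P Q)
    then show ?case
      by (simp add: distrib_left)
  next
    case (mult l d P)
    let ?L = "\<lambda>w. mat m m (\<lambda>(i, j). l i (w j))"
    have "?L w' = ?L w * ?A"
      using mult(1)
      by (intro eq_matI)
        (auto simp: a scalar_prod_def atLeast0LessThan lin_form_sum lin_form_scale mult.commute)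
    then have "det (?L w') = det (?L w) * det ?A"
      using det_mult[of "?L w" m ?A] by simp
    then show ?case
      by (simp add: mult.IH ac_simps)
  qed
  then show ?thesis
    by (rule that)
qed

lemma pluecker_form_nonzero_frame:
  assumes "frame scale m W w" "frame scale m W w'" "pluecker_form scale m d P" "P w' \<noteq> 0"
  shows "P w \<noteq> 0"
  using pluecker_form_frame_change[OF assms(1,2)] assms(3,4) by (metis mult_zero_right)

lemma pluecker_form_quotient:
  assumes w: "frame scale m W w" and w': "frame scale m W w'"
    and P: "pluecker_form scale m d P" and Q: "pluecker_form scale m d Q" and "Q w' \<noteq> 0"
  shows "P w' / Q w' = P w / Q w"
proof -
  obtain c where "P w' = c ^ d * P w" "Q w' = c ^ d * Q w"
    using pluecker_form_frame_change[OF w w'] P Q by metis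
  then show ?thesis
    using assms(5) by auto
qed

text \<open>The generating open sets of \<open>grassmannian\<close>. The existential quantifier over
  frames has the strength of a universal one, by \<open>pluecker_openD\<close>.\<close>

definition pluecker_open :: "nat \<Rightarrow> ((nat \<Rightarrow> 'b) \<Rightarrow> 'a) \<Rightarrow> 'b set set" where
  "pluecker_open m P = {W. subspace W \<and> dim W = m \<and> (\<exists>w. frame scale m W w \<and> P w \<noteq> 0)}"

lemma openin_pluecker_open:
  "pluecker_form scale m d P \<Longrightarrow> openin (zariski (grassmannian scale m)) (pluecker_open m P)"
  unfolding grassmannian_def Let_def pluecker_open_def by (auto intro!: topology_generated_by_Basis)

lemma grassmannian_points: "points (grassmannian scale m) = {W. subspace W \<and> dim W = m}"
proof -
  have "W \<in> points (grassmannian scale m)" if W: "subspace W" "dim W = m" for W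
  proof -
    obtain w where "frame scale m W w"
      using frame_exists W by blast
    then have "W \<in> pluecker_open m (\<lambda>w. 1)"
      using W unfolding pluecker_open_def by auto
    then show ?thesis
      using openin_subset[OF openin_pluecker_open[OF pluecker_form.const[of scale m 1]]] by auto
  qed
  then show ?thesis
    unfolding grassmannian_def Let_def by auto
qed

lemma pluecker_openD:
  assumes "W \<in> pluecker_open m P" "pluecker_form scale m d P" "frame scale m W w"
  shows "P w \<noteq> 0"
  using assms pluecker_form_nonzero_frame unfolding pluecker_open_def by blast

lemma quotient_regular_on_grassmannian:
  assumes P: "pluecker_form scale m d P" and Q: "pluecker_form scale m d Q"
    and U: "openin (zariski (grassmannian scale m)) U" "U \<subseteq> pluecker_open m Q"
  obtains g where "g \<in> regular (grassmannian scale m) U"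
    "\<And>W w. W \<in> U \<Longrightarrow> frame scale m W w \<Longrightarrow> g W = P w / Q w"
proof -
  let ?f = "\<lambda>W. SOME w. frame scale m W w"
  define g where "g = (\<lambda>W\<in>U. P (?f W) / Q (?f W))"
  have Q0: "Q w \<noteq> 0" if "W \<in> U" "frame scale m W w" for W w
    using pluecker_openD Q U(2) that by blast
  have g: "g W = P w / Q w" if "W \<in> U" "frame scale m W w" for W w
  proof -
    have f: "frame scale m W (?f W)"
      using that(2) by (rule someI[of "frame scale m W"])
    show ?thesis
      using that(1) pluecker_form_quotient[OF that(2) f P Q Q0[OF that(1) f]] by (simp add: g_def)
  qed
  have "\<forall>W\<in>U. \<exists>U'. openin (zariski (grassmannian scale m)) U' \<and> W \<in> U' \<and> U' \<subseteq> U \<and>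
      (\<exists>d P Q. pluecker_form scale m d P \<and> pluecker_form scale m d Q \<and>
         (\<forall>W'\<in>U'. \<forall>w. frame scale m W' w \<longrightarrow> Q w \<noteq> 0 \<and> g W' = P w / Q w))"
    using U(1) P Q Q0 g
    by (intro ballI exI[of _ U] conjI exI[of _ d] exI[of _ P] exI[of _ Q]) auto
  moreover have "g \<in> extensional U"
    by (simp add: g_def)
  ultimately have "g \<in> regular (grassmannian scale m) U"
    unfolding grassmannian_def Let_def by simp
  then show ?thesis
    using g that by blast
qed

lemma grassmannian_regularD:
  assumes "g \<in> regular (grassmannian scale m) U" "W \<in> U"
  obtains U' d P Q where "openin (zariski (grassmannian scale m)) U'" "W \<in> U'" "U' \<subseteq> U"
    "pluecker_form scale m d P" "pluecker_form scale m d Q"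
    "\<And>W' w. W' \<in> U' \<Longrightarrow> frame scale m W' w \<Longrightarrow> Q w \<noteq> 0 \<and> g W' = P w / Q w"
  using assms unfolding grassmannian_def Let_def by auto

text \<open>The dual-space fact that finitely many functionals span all those vanishing on their
  common kernel. It is proved by induction on the index set because \<open>H\<close> is a set of
  maps extensional on \<open>M\<close>, with operations restricted to \<open>M\<close>.\<close>

lemma functional_in_span:
  assumes "finite I"
    and H_add: "\<And>f g. f \<in> H \<Longrightarrow> g \<in> H \<Longrightarrow> (\<lambda>v\<in>M. f v + g v) \<in> H"
    and H_scale: "\<And>c f. f \<in> H \<Longrightarrow> (\<lambda>v\<in>M. scale c (f v)) \<in> H"
    and "\<And>i. i \<in> I \<Longrightarrow> \<phi> i \<in> functionals scale M H"
    and "l \<in> functionals scale M H"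
    and "\<And>f. f \<in> H \<Longrightarrow> (\<And>i. i \<in> I \<Longrightarrow> \<phi> i f = 0) \<Longrightarrow> l f = 0"
  shows "\<exists>a. \<forall>f\<in>H. l f = (\<Sum>i\<in>I. a i * \<phi> i f)"
  using assms(1,4-)
proof (induction I arbitrary: l)
  case empty
  then show ?case
    by simp
next
  case (insert k I)
  have add: "\<psi> (\<lambda>v\<in>M. f v + g v) = \<psi> f + \<psi> g" and sc: "\<psi> (\<lambda>v\<in>M. scale c (f v)) = c * \<psi> f"
    if "\<psi> \<in> functionals scale M H" "f \<in> H" "g \<in> H" for \<psi> f g c
    using that unfolding functionals_def by auto
  have \<phi>k: "\<phi> k \<in> functionals scale M H" and \<phi>: "\<And>i. i \<in> I \<Longrightarrow> \<phi> i \<in> functionals scale M H"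
    using insert.prems(1) by auto
  note l = insert.prems(2)
  show ?case
  proof (cases "\<forall>f\<in>H. (\<forall>i\<in>I. \<phi> i f = 0) \<longrightarrow> \<phi> k f = 0")
    case True
    then have "l f = 0" if "f \<in> H" "\<And>i. i \<in> I \<Longrightarrow> \<phi> i f = 0" for f
      using insert.prems(3) that by auto
    then obtain a where a: "\<forall>f\<in>H. l f = (\<Sum>i\<in>I. a i * \<phi> i f)"
      using insert.IH[OF \<phi> l] by blast
    have "l f = (\<Sum>i\<in>insert k I. (a(k := 0)) i * \<phi> i f)" if "f \<in> H" for f
    proof -
      have "(\<Sum>i\<in>I. (a(k := 0)) i * \<phi> i f) = l f"
        using a that insert.hyps by (auto intro!: sum.cong)
      then show ?thesis
        using insert.hyps by simp
    qed
    then show ?thesis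
      by blast
  next
    case False
    then obtain h where h: "h \<in> H" "\<And>i. i \<in> I \<Longrightarrow> \<phi> i h = 0" "\<phi> k h \<noteq> 0"
      by blast
    \<comment> \<open>Evaluation at \<open>h\<close>, where the functionals indexed by
      \<open>I\<close> vanish, forces this coefficient of \<open>\<phi> k\<close>; the induction
      hypothesis is applied to what remains of \<open>l\<close>.\<close>
    define b where "b = l h / \<phi> k h"
    define l' where "l' f = l f - b * \<phi> k f" for f
    have l': "l' \<in> functionals scale M H"
      using l \<phi>k unfolding functionals_def l'_def by (auto simp: algebra_simps)
    have "l' f = 0" if f: "f \<in> H" "\<And>i. i \<in> I \<Longrightarrow> \<phi> i f = 0" for f
    proof -
      \<comment> \<open>A multiple of \<open>h\<close> is added to \<open>f\<close> so that
        \<open>\<phi> k\<close> vanishes too, without disturbing the other functionals.\<close>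
      define h' where "h' = (\<lambda>v\<in>M. scale (- (\<phi> k f / \<phi> k h)) (h v))"
      have h': "h' \<in> H" "\<And>\<psi>. \<psi> \<in> functionals scale M H \<Longrightarrow> \<psi> h' = - (\<phi> k f / \<phi> k h) * \<psi> h"
        unfolding h'_def using H_scale[OF h(1)] sc[OF _ h(1) h(1)] by blast+
      have "l (\<lambda>v\<in>M. f v + h' v) = 0"
      proof (rule insert.prems(3))
        show "(\<lambda>v\<in>M. f v + h' v) \<in> H"
          using H_add f(1) h'(1) .
        fix i assume i: "i \<in> insert k I"
        then have \<psi>: "\<phi> i \<in> functionals scale M H"
          using \<phi>k \<phi> by blast
        have "\<phi> i (\<lambda>v\<in>M. f v + h' v) = \<phi> i f + - (\<phi> k f / \<phi> k h) * \<phi> i h"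
          unfolding add[OF \<psi> f(1) h'(1)] h'(2)[OF \<psi>] by (rule refl)
        also have "\<dots> = 0"
          using i h(2,3) f(2) by (cases "i = k") auto
        finally show "\<phi> i (\<lambda>v\<in>M. f v + h' v) = 0" .
      qed
      then have "l f + - (\<phi> k f / \<phi> k h) * l h = 0"
        unfolding add[OF l f(1) h'(1)] h'(2)[OF l] .
      then show ?thesis
        by (simp add: l'_def b_def)
    qed
    then obtain a where a: "\<forall>f\<in>H. l' f = (\<Sum>i\<in>I. a i * \<phi> i f)"
      using insert.IH[OF \<phi> l'] by blast
    have "l f = (\<Sum>i\<in>insert k I. (a(k := b)) i * \<phi> i f)" if "f \<in> H" for f
    proof -
      have "(\<Sum>i\<in>I. (a(k := b)) i * \<phi> i f) = l' f"
        using a that insert.hyps by (auto intro!: sum.cong)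
      then show ?thesis
        using insert.hyps by (simp add: l'_def)
    qed
    then show ?thesis
      by blast
  qed
qed

end

section \<open>Graphs and slopes\<close>

context Gr_decomposition
begin

abbreviation "grass \<equiv> grassmannian scale (dim M)"
abbreviation "SM \<equiv> summands G r scale \<rho> M"
abbreviation "SV \<equiv> summand_variety G r scale \<rho> M"
abbreviation "HV \<equiv> Hom_variety G r scale \<rho> M N"
abbreviation "HA \<equiv> fun_algebra (Hom M N) (functionals scale M (Hom M N))"

lemma zariski_SV: "zariski SV = subtopology (zariski grass) SM"
  unfolding summand_variety_def subvariety_def by simp

lemma regular_SV:
  "regular SV U = {h \<in> extensional U. \<forall>x\<in>U. \<exists>U'. openin (zariski grass) U' \<and> x \<in> U' \<and>
     (\<exists>g \<in> regular grass U'. \<forall>y \<in> U \<inter> U'. h y = g y)}"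
  unfolding summand_variety_def subvariety_def by simp

lemma HV_eq: "HV = affine_fun_space (Hom M N) HA"
  unfolding Hom_variety_def by (simp add: Let_def)

lemma regular_HV:
  "regular HV U = {h \<in> extensional U. \<forall>x\<in>U. \<exists>U'. openin (zariski HV) U' \<and> x \<in> U' \<and> U' \<subseteq> U \<and>
     (\<exists>f\<in>HA. \<exists>g\<in>HA. \<forall>y\<in>U'. g y \<noteq> 0 \<and> h y = f y / g y)}"
  unfolding HV_eq affine_fun_space_def by (simp add: Let_def)

lemma points_HV: "points HV = Hom M N"
  unfolding HV_eq by (rule affine_fun_space_points[OF fun_algebra.const])

lemma points_SV: "points SV = SM"
  using summands_dim summand_subspace by (auto simp: zariski_SV grassmannian_points)

text \<open>On \<open>M\<close> the inner \<open>p\<close> is the identity; it exhibits the graph as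
  the image of \<open>M\<close> under a shear in \<open>Endo\<close>, hence as a summand.\<close>

definition graph :: "('v \<Rightarrow> 'v) \<Rightarrow> 'v set" where
  "graph b = (\<lambda>v. v + b (p v)) ` M"

text \<open>For a complement \<open>W\<close> of \<open>N\<close>, the point of \<open>W\<close>
  above \<open>m\<close> is the projection of \<open>m\<close> to \<open>W\<close> along
  \<open>N\<close>; its \<open>N\<close>-component is the value at \<open>m\<close> of the map with
  graph \<open>W\<close>.\<close>

definition slope :: "'v set \<Rightarrow> 'v \<Rightarrow> 'v" where
  "slope W = (\<lambda>m\<in>M. q (proj_along W N m))"

lemma shear:
  assumes "b \<in> Hom M N"
  shows "(\<lambda>v. v + b (p v)) \<in> Endo" "inj (\<lambda>v. v + b (p v))"
proof -
  show "(\<lambda>v. v + b (p v)) \<in> Endo"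
    using Endo_add[OF Endo_id Hom_M_Endo[OF assms]] .
  show "inj (\<lambda>v. v + b (p v))"
  proof (rule injI)
    fix u v assume uv: "u + b (p u) = v + b (p v)"
    have "p u = p v"
      using arg_cong[OF uv, of p] Gr_hom_mem[OF assms p_mem] by (simp add: p_add)
    then show "u = v"
      using uv by simp
  qed
qed

lemma graph_in_summands: "b \<in> Hom M N \<Longrightarrow> graph b \<in> SM"
  unfolding graph_def by (intro image_in_summands shear)

lemma slope_graph:
  assumes rigid and b: "b \<in> Hom M N"
  shows "slope (graph b) = b"
proof
  fix v
  have c: "Gr_complement G r scale \<rho> (graph b) N"
    using rigid_imp_complements[OF assms(1) graph_in_summands[OF b]] .
  then have sub: "subspace (graph b)" "subspace N" "complementary (graph b) N"
    using Gr_complement_iff by auto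
  show "slope (graph b) v = b v"
  proof (cases "v \<in> M")
    case True
    then have bv: "b v \<in> N" and "v + b v \<in> graph b"
      using Gr_hom_mem[OF b] unfolding graph_def by (auto intro: rev_image_eqI)
    moreover have "v - (v + b v) \<in> N"
      using subspace_neg[OF sub_N bv] by simp
    ultimately have "proj_along (graph b) N v = v + b v"
      using proj_along_unique[OF sub] by blast
    then show ?thesis
      using True bv by (simp add: slope_def q_add)
  next
    case False
    then show ?thesis
      using Gr_hom_extensional[OF b] by (simp add: slope_def extensional_def)
  qed
qed

lemma slope_Hom: "rigid \<Longrightarrow> W \<in> SM \<Longrightarrow> slope W \<in> Hom M N"
  unfolding slope_def using summand_hom(1) rigid_imp_complements by blast

lemma graph_slope:
  assumes rigid and W: "W \<in> SM"
  shows "graph (slope W) = W"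
proof -
  have c: "Gr_complement G r scale \<rho> W N"
    using rigid_imp_complements[OF assms] .
  then have sub: "subspace W" "subspace N" "complementary W N"
    using Gr_complement_iff by auto
  have *: "m + slope W m = proj_along W N m" if m: "m \<in> M" for m
  proof -
    have "p (m - proj_along W N m) = 0"
      using proj_along_diff_mem[OF sub] by simp
    then have "p (proj_along W N m) = m"
      using m by (simp add: lin_diff[OF p_lin])
    then show ?thesis
      using p_plus_q[of "proj_along W N m"] m by (simp add: slope_def)
  qed
  show ?thesis
  proof
    show "graph (slope W) \<subseteq> W"
      using proj_along_mem[OF sub] by (auto simp: graph_def *)
    show "W \<subseteq> graph (slope W)"
    proof
      fix v assume "v \<in> W"
      then have "v = p v + slope W (p (p v))"
        using summand_hom(2)[OF c, of v] *[of "p v"] by simp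
      then show "v \<in> graph (slope W)"
        unfolding graph_def by (rule image_eqI) simp
    qed
  qed
qed

section \<open>Pluecker coordinates of graphs\<close>

lemma functional_eval:
  assumes "lin_form l"
  shows "(\<lambda>b. l (b (p v))) \<in> functionals scale M (Hom M N)"
  unfolding functionals_def using lin_form_add[OF assms] lin_form_scale[OF assms] by simp

text \<open>The frame of the graph of \<open>b\<close> obtained by applying the shear to
  \<open>\<mu>\<close>. It is affine in \<open>b\<close>, so forms can be evaluated on graphs
  without choosing a frame each time.\<close>

abbreviation "lift \<mu> b j \<equiv> \<mu> j + b (p (\<mu> j))"

lemma frame_lift:
  "frame scale n M \<mu> \<Longrightarrow> b \<in> Hom M N \<Longrightarrow> frame scale n (graph b) (lift \<mu> b)"
  unfolding graph_def by (rule frame_image) (auto intro: shear Endo_lin)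

text \<open>Each entry \<open>l i (lift \<mu> b j)\<close> is a constant plus a linear functional of
  \<open>b\<close>, so its determinants are polynomials in \<open>b\<close>.\<close>

lemma pluecker_form_lift:
  "pluecker_form scale n d P \<Longrightarrow> (\<lambda>b\<in>Hom M N. P (lift \<mu> b)) \<in> HA"
proof (induction rule: pluecker_form.induct)
  case (const c)
  show ?case
    by (rule fun_algebra.const)
next
  case (add d P Q)
  then show ?case
    by (intro restrict_fun_algebra_add)
next
  case (mult l d P)
  have "(\<lambda>b\<in>Hom M N. l i (lift \<mu> b j)) \<in> HA" if "i < n" for i j
  proof -
    have l: "lin_form (l i)"
      using mult(1) that by blast
    show ?thesis
      unfolding lin_form_add[OF l]
      by (intro restrict_fun_algebra_add fun_algebra.const fun_algebra.gen functional_eval[OF l])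
  qed
  then have "(\<lambda>b\<in>Hom M N. det (mat n n (\<lambda>(i, j). l i (lift \<mu> b j)))) \<in> HA"
    by (intro restrict_fun_algebra_det)
  then show ?case
    using mult.IH by (rule restrict_fun_algebra_mult)
qed

lemma graph_continuous: "continuous_map (zariski HV) (zariski SV) graph"
proof -
  obtain \<mu> where \<mu>: "frame scale (dim M) M \<mu>"
    using frame_exists[OF sub_M] by blast
  let ?B = "{{W. subspace W \<and> dim W = dim M \<and> (\<exists>w. frame scale (dim M) W w \<and> P w \<noteq> 0)} | d P.
      pluecker_form scale (dim M) d P}"
  have grass: "zariski grass = topology_generated_by ?B"
    unfolding grassmannian_def by (simp add: Let_def)
  have "continuous_map (zariski HV) (topology_generated_by ?B) graph"
  proof (rule continuous_on_generated_topo)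
    fix U assume "U \<in> ?B"
    then obtain d P where P: "pluecker_form scale (dim M) d P" and U: "U = pluecker_open (dim M) P"
      unfolding pluecker_open_def by blast
    let ?f = "\<lambda>b\<in>Hom M N. P (lift \<mu> b)"
    have "graph b \<in> U \<longleftrightarrow> ?f b \<noteq> 0" if b: "b \<in> Hom M N" for b
    proof
      show "graph b \<in> U \<Longrightarrow> ?f b \<noteq> 0"
        using pluecker_openD[OF _ P frame_lift[OF \<mu> b]] b U by simp
      have "subspace (graph b)" "dim (graph b) = dim M"
        using frame_dim[OF frame_lift[OF \<mu> b]] by auto
      then show "?f b \<noteq> 0 \<Longrightarrow> graph b \<in> U"
        using frame_lift[OF \<mu> b] b unfolding U pluecker_open_def by auto
    qed
    then have *: "graph -` U \<inter> points HV = {b \<in> Hom M N. ?f b \<noteq> 0}"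
      unfolding points_HV by blast
    have "openin (zariski HV) {b \<in> Hom M N. ?f b \<noteq> 0}"
      unfolding HV_eq by (rule affine_fun_space_basic_open[OF pluecker_form_lift[OF P]])
    then show "openin (zariski HV) (graph -` U \<inter> points HV)"
      by (simp only: *)
  next
    have "graph ` points HV \<subseteq> points SV"
      unfolding points_HV points_SV using graph_in_summands by blast
    also have "\<dots> \<subseteq> points grass"
      by (simp add: zariski_SV)
    finally show "graph ` points HV \<subseteq> \<Union> ?B"
      unfolding grass topology_generated_by_topspace .
  qed
  then show ?thesis
    unfolding zariski_SV grass continuous_map_in_subtopology points_HV
    using graph_in_summands by blast
qed

lemma graph_morphism: "variety_morphism HV SV graph"
  unfolding variety_morphism_def
proof (intro conjI allI impI ballI)
  show cont: "continuous_map (zariski HV) (zariski SV) graph"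
    by (rule graph_continuous)
  obtain \<mu> where \<mu>: "frame scale (dim M) M \<mu>"
    using frame_exists[OF sub_M] by blast
  fix U h assume U: "openin (zariski SV) U" and h: "h \<in> regular SV U"
  let ?V = "{b \<in> points HV. graph b \<in> U}"
  have "\<exists>U'. openin (zariski HV) U' \<and> b \<in> U' \<and> U' \<subseteq> ?V \<and>
      (\<exists>f\<in>HA. \<exists>g\<in>HA. \<forall>y\<in>U'. g y \<noteq> 0 \<and> restrict (h \<circ> graph) ?V y = f y / g y)"
    if b: "b \<in> ?V" for b
  proof -
    \<comment> \<open>Regularity is local twice: \<open>h\<close> agrees near \<open>graph b\<close>
      with a regular function of the Grassmannian, and that function is a quotient of forms on a
      smaller neighbourhood. The preimage of the latter is used.\<close>
    obtain U1 g where U1: "openin (zariski grass) U1" "graph b \<in> U1" "g \<in> regular grass U1"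
      "\<And>y. y \<in> U \<inter> U1 \<Longrightarrow> h y = g y"
      using h b unfolding regular_SV by blast
    obtain U2 d P Q where U2: "openin (zariski grass) U2" "graph b \<in> U2" "U2 \<subseteq> U1"
      and P: "pluecker_form scale (dim M) d P" and Q: "pluecker_form scale (dim M) d Q"
      and PQ: "\<And>W w. W \<in> U2 \<Longrightarrow> frame scale (dim M) W w \<Longrightarrow> Q w \<noteq> 0 \<and> g W = P w / Q w"
      using grassmannian_regularD[OF U1(3,2)] by blast
    let ?U' = "{c \<in> points HV. graph c \<in> U \<inter> (U2 \<inter> SM)}"
    have "openin (zariski SV) (U2 \<inter> SM)"
      unfolding zariski_SV openin_subtopology using U2(1) by blast
    then have "openin (zariski SV) (U \<inter> (U2 \<inter> SM))"
      by (rule openin_Int[OF U])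
    then have 1: "openin (zariski HV) ?U'"
      by (rule openin_continuous_map_preimage[OF cont])
    have 2: "b \<in> ?U'"
      using b U2(2) graph_in_summands unfolding points_HV by blast
    have 3: "?U' \<subseteq> ?V"
      by blast
    have 4: "\<forall>c\<in>?U'. (\<lambda>b\<in>Hom M N. Q (lift \<mu> b)) c \<noteq> 0 \<and>
        restrict (h \<circ> graph) ?V c = (\<lambda>b\<in>Hom M N. P (lift \<mu> b)) c / (\<lambda>b\<in>Hom M N. Q (lift \<mu> b)) c"
    proof
      fix c assume c: "c \<in> ?U'"
      have cH: "c \<in> Hom M N"
        using c points_HV by simp
      have "Q (lift \<mu> c) \<noteq> 0 \<and> g (graph c) = P (lift \<mu> c) / Q (lift \<mu> c)"
        using PQ[OF _ frame_lift[OF \<mu> cH]] c by blast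
      moreover have "h (graph c) = g (graph c)"
        using U1(4) U2(3) c by blast
      ultimately show "(\<lambda>b\<in>Hom M N. Q (lift \<mu> b)) c \<noteq> 0 \<and>
          restrict (h \<circ> graph) ?V c = (\<lambda>b\<in>Hom M N. P (lift \<mu> b)) c / (\<lambda>b\<in>Hom M N. Q (lift \<mu> b)) c"
        using c cH by simp
    qed
    show ?thesis
      by (rule exI[of _ ?U'], intro conjI 1 2 3, rule bexI[where x = "\<lambda>b\<in>Hom M N. P (lift \<mu> b)"],
          rule bexI[where x = "\<lambda>b\<in>Hom M N. Q (lift \<mu> b)"])
        (fact 4 pluecker_form_lift[OF Q] pluecker_form_lift[OF P])+
  qed
  then show "restrict (h \<circ> graph) ?V \<in> regular HV ?V"
    unfolding regular_HV by simp
qed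

text \<open>On the graph of \<open>b\<close> the Pluecker coordinate \<open>D\<close> of a basis \<open>\<mu>\<close> of \<open>M\<close> is invertible, and the
  coordinates that arise by replacing one dual basis vector by a linear form \<open>\<eta>\<close> on \<open>N\<close> are the
  matrix coefficients \<open>\<eta> (b (\<mu> k))\<close>.\<close>

lemma matrix_coefficient_pluecker:
  assumes \<mu>: "frame scale n M \<mu>"
  obtains D where "pluecker_form scale n 1 D" "\<And>b. b \<in> Hom M N \<Longrightarrow> D (lift \<mu> b) = 1"
    "\<And>\<eta> k. lin_form \<eta> \<Longrightarrow> (\<And>v. v \<in> M \<Longrightarrow> \<eta> v = 0) \<Longrightarrow> k < n \<Longrightarrow>
       \<exists>P. pluecker_form scale n 1 P \<and> (\<forall>b\<in>Hom M N. P (lift \<mu> b) = \<eta> (b (p (\<mu> k))))"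
proof -
  let ?B = "\<mu> ` {..<n}"
  have inj: "inj_on \<mu> {..<n}" and ind: "independent ?B" and sp: "span ?B = M"
    using \<mu> unfolding frame_def by auto
  have p_sp: "p v \<in> span ?B" for v
    by (simp add: sp)
  \<comment> \<open>The coordinate forms of the frame are extended to \<open>V\<close> through
    \<open>p\<close>; they vanish on \<open>N\<close>, so on a lifted frame they give the identity
    matrix.\<close>
  define l where "l i v = representation ?B (p v) (\<mu> i)" for i v
  have l: "lin_form (l i)" for i
    unfolding lin_form_iff l_def
    by (simp add: p_add lin_scale[OF p_lin] representation_add[OF ind p_sp p_sp]
        representation_scale[OF ind p_sp])
  have l_lift: "l i (lift \<mu> b j) = (if i = j then 1 else 0)"
    if "b \<in> Hom M N" "i < n" "j < n" for b i j
  proof -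
    have "p (lift \<mu> b j) = \<mu> j"
      using frame_mem[OF \<mu> that(3)] Gr_hom_mem[OF that(1)] by (simp add: p_add)
    moreover have "\<mu> i = \<mu> j \<longleftrightarrow> i = j"
      using inj that unfolding inj_on_def by auto
    ultimately show ?thesis
      using representation_basis[OF ind, of "\<mu> j"] that by (simp add: l_def)
  qed
  let ?D = "\<lambda>w. det (mat n n (\<lambda>(i, j). l i (w j)))"
  have "?D (lift \<mu> b) = 1" if "b \<in> Hom M N" for b
  proof -
    have "mat n n (\<lambda>(i, j). l i (lift \<mu> b j)) = 1\<^sub>m n"
      using l_lift[OF that] by (intro eq_matI) auto
    then show ?thesis
      by simp
  qed
  moreover have "\<exists>P. pluecker_form scale n 1 P \<and> (\<forall>b\<in>Hom M N. P (lift \<mu> b) = \<eta> (b (p (\<mu> k))))"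
    if \<eta>: "lin_form \<eta>" "\<And>v. v \<in> M \<Longrightarrow> \<eta> v = 0" and k: "k < n" for \<eta> k
  proof -
    \<comment> \<open>Only row \<open>k\<close> changes. As \<open>\<eta>\<close> vanishes on
      \<open>M\<close>, that row no longer sees the frame of \<open>M\<close> but only the values of
      \<open>b\<close>.\<close>
    define l' where "l' i = (if i = k then \<eta> else l i)" for i
    let ?P = "\<lambda>w. det (mat n n (\<lambda>(i, j). l' i (w j)))"
    have "?P (lift \<mu> b) = \<eta> (b (p (\<mu> k)))" if b: "b \<in> Hom M N" for b
    proof -
      have "mat n n (\<lambda>(i, j). l' i (lift \<mu> b j)) =
          mat n n (\<lambda>(i, j). if i = k then \<eta> (b (p (\<mu> j))) else if i = j then 1 else 0)"
        using l_lift[OF b] \<eta>(2)[OF frame_mem[OF \<mu>]]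
        by (intro eq_matI) (auto simp: l'_def lin_form_add[OF \<eta>(1)])
      then show ?thesis
        using det_unit_with_row[OF k] by simp
    qed
    moreover have "pluecker_form scale n 1 ?P"
      by (rule pluecker_form_det) (simp add: l'_def l \<eta>)
    ultimately show ?thesis
      by blast
  qed
  moreover have "pluecker_form scale n 1 ?D"
    by (rule pluecker_form_det) (rule l)
  ultimately show ?thesis
    using that[of ?D] by blast
qed

section \<open>Polynomial functions on the Hom space as Pluecker forms\<close>

lemma Hom_add:
  assumes f: "f \<in> Hom M N" and g: "g \<in> Hom M N"
  shows "(\<lambda>v\<in>M. f v + g v) \<in> Hom M N"
proof -
  have "(\<lambda>v\<in>M. f (p v) + g (p v)) \<in> Hom M N"
    by (rule restrict_M_Hom[OF Endo_add[OF Hom_M_Endo[OF f] Hom_M_Endo[OF g]]])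
      (rule subspace_add[OF sub_N Gr_hom_mem[OF f p_mem] Gr_hom_mem[OF g p_mem]])
  also have "(\<lambda>v\<in>M. f (p v) + g (p v)) = (\<lambda>v\<in>M. f v + g v)"
    by (rule restrict_ext) simp
  finally show ?thesis .
qed

lemma Hom_scale:
  assumes f: "f \<in> Hom M N"
  shows "(\<lambda>v\<in>M. scale c (f v)) \<in> Hom M N"
proof -
  have "(\<lambda>v\<in>M. scale c (f (p v))) \<in> Hom M N"
    by (rule restrict_M_Hom[OF Endo_scale[OF Hom_M_Endo[OF f]]])
      (rule subspace_scale[OF sub_N Gr_hom_mem[OF f p_mem]])
  also have "(\<lambda>v\<in>M. scale c (f (p v))) = (\<lambda>v\<in>M. scale c (f v))"
    by (rule restrict_ext) simp
  finally show ?thesis .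
qed

text \<open>An element of \<open>Hom M N\<close> is determined by the coordinates of its values on
  the frame, so these coordinates have trivial common kernel and span the functionals.\<close>

lemma functional_matrix_coefficients:
  assumes \<mu>: "frame scale n M \<mu>" and l: "l \<in> functionals scale M (Hom M N)"
  obtains a where "\<And>b. b \<in> Hom M N \<Longrightarrow>
    l b = (\<Sum>i\<in>Basis \<times> {..<n}. a i * representation Basis (q (b (p (\<mu> (snd i))))) (fst i))"
proof -
  \<comment> \<open>\<open>Basis\<close> need not be adapted to the decomposition. Composing with
    \<open>q\<close> makes the coordinate form vanish on \<open>M\<close>, as
    \<open>matrix_coefficient_pluecker\<close> demands.\<close>
  have lf: "lin_form (\<lambda>v. representation Basis (q v) t)" for t
    unfolding lin_form_iff
    by (simp add: q_add lin_scale[OF q_lin] representation_add[OF independent_Basis]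
        representation_scale[OF independent_Basis] span_Basis)
  have "l f = 0"
    if f: "f \<in> Hom M N"
      and 0: "\<And>i. i \<in> Basis \<times> {..<n} \<Longrightarrow> representation Basis (q (f (p (\<mu> (snd i))))) (fst i) = 0"
    for f
  proof -
    have "f (p (\<mu> k)) = 0" if "k < n" for k
    proof -
      have "q (f (p (\<mu> k))) = (\<Sum>t\<in>Basis. scale (representation Basis (q (f (p (\<mu> k)))) t) t)"
        using sum_representation_eq[OF independent_Basis _ finite_Basis] span_Basis by auto
      also have "\<dots> = 0"
        using 0[of "(t, k)" for t] that by simp
      finally show ?thesis
        using Gr_hom_mem[OF f] by simp
    qed
    then have "f (p v) = 0" if "v \<in> span (\<mu> ` {..<n})" for v
      using module_hom.eq_0_on_span[of scale scale "\<lambda>v. f (p v)" "\<mu> ` {..<n}" v] that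
        Endo_lin[OF Hom_M_Endo[OF f]] by (auto simp: module_hom_iff_linear)
    then have "f v = 0" if "v \<in> M" for v
      using \<mu> that unfolding frame_def by (metis p_M)
    \<comment> \<open>Now \<open>f\<close> is the zero map; homogeneity of \<open>l\<close> with
      scalar 0 gives \<open>l f = 0\<close>.\<close>
    then have "f = (\<lambda>v\<in>M. scale 0 (f v))"
      using Gr_hom_extensional[OF f] by (auto simp: extensional_def)
    moreover have "l (\<lambda>v\<in>M. scale 0 (f v)) = 0 * l f"
      using l f unfolding functionals_def by blast
    ultimately show ?thesis
      by simp
  qed
  then have "\<exists>a. \<forall>b\<in>Hom M N.
      l b = (\<Sum>i\<in>Basis \<times> {..<n}. a i * representation Basis (q (b (p (\<mu> (snd i))))) (fst i))"
    using finite_Basis Hom_add Hom_scale functional_eval[OF lf] l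
    by (intro functional_in_span) auto
  then show ?thesis
    using that by blast
qed

text \<open>Homogenisation: matrix coefficients are values of forms of degree one, and
  \<open>D\<close> plays the part of the homogenising variable.\<close>

lemma coordinate_pluecker:
  assumes \<mu>: "frame scale n M \<mu>"
  obtains D where "pluecker_form scale n 1 D" "\<And>b. b \<in> Hom M N \<Longrightarrow> D (lift \<mu> b) = 1"
    "\<And>f. f \<in> HA \<Longrightarrow> \<exists>e P. pluecker_form scale n e P \<and> (\<forall>b\<in>Hom M N. P (lift \<mu> b) = f b)"
proof -
  obtain D where D: "pluecker_form scale n 1 D" "\<And>b. b \<in> Hom M N \<Longrightarrow> D (lift \<mu> b) = 1"
    "\<And>\<eta> k. lin_form \<eta> \<Longrightarrow> (\<And>v. v \<in> M \<Longrightarrow> \<eta> v = 0) \<Longrightarrow> k < n \<Longrightarrow>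
       \<exists>P. pluecker_form scale n 1 P \<and> (\<forall>b\<in>Hom M N. P (lift \<mu> b) = \<eta> (b (p (\<mu> k))))"
    using matrix_coefficient_pluecker[OF \<mu>] by blast
  define rep where
    "rep f \<longleftrightarrow> (\<exists>e P. pluecker_form scale n e P \<and> (\<forall>b\<in>Hom M N. P (lift \<mu> b) = f b))" for f
  have rep_cong: "rep f" if "rep g" "\<And>b. b \<in> Hom M N \<Longrightarrow> f b = g b" for f g
    using that unfolding rep_def by simp
  have rep_const: "rep (\<lambda>b. c)" for c
    unfolding rep_def using pluecker_form.const[of scale n c] by blast
  have rep_mult: "rep (\<lambda>b. f b * g b)" if f: "rep f" and g: "rep g" for f g
  proof -
    obtain d P where P: "pluecker_form scale n d P" "\<forall>b\<in>Hom M N. P (lift \<mu> b) = f b"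
      using f unfolding rep_def by blast
    obtain e Q where Q: "pluecker_form scale n e Q" "\<forall>b\<in>Hom M N. Q (lift \<mu> b) = g b"
      using g unfolding rep_def by blast
    show ?thesis
      unfolding rep_def
      by (intro exI[of _ "d + e"] exI[of _ "\<lambda>w. P w * Q w"])
        (simp add: pluecker_form_mult[OF P(1) Q(1)] P(2) Q(2))
  qed
  have rep_add: "rep (\<lambda>b. f b + g b)" if f: "rep f" and g: "rep g" for f g
  proof -
    obtain d P where P: "pluecker_form scale n d P" "\<forall>b\<in>Hom M N. P (lift \<mu> b) = f b"
      using f unfolding rep_def by blast
    obtain e Q where Q: "pluecker_form scale n e Q" "\<forall>b\<in>Hom M N. Q (lift \<mu> b) = g b"
      using g unfolding rep_def by blast
    \<comment> \<open>Forms can be added only in equal degree; the powers of \<open>D\<close> bring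
      both to degree \<open>d + e\<close> and take the value 1 on lifted frames.\<close>
    have "pluecker_form scale n (d + e) (\<lambda>w. P w * D w ^ e + Q w * D w ^ d)"
      using pluecker_form_mult[OF P(1) pluecker_form_power[OF D(1), of e]]
        pluecker_form_mult[OF Q(1) pluecker_form_power[OF D(1), of d]]
      by (intro pluecker_form.add) (simp_all add: add.commute)
    then show ?thesis
      unfolding rep_def
      by (intro exI[of _ "d + e"] exI[of _ "\<lambda>w. P w * D w ^ e + Q w * D w ^ d"])
        (simp add: P(2) Q(2) D(2))
  qed
  have rep_sum: "rep (\<lambda>b. \<Sum>i\<in>I. f i b)" if "\<And>i. i \<in> I \<Longrightarrow> rep (f i)" for f and I :: "('v \<times> nat) set"
    using that by (induction I rule: infinite_finite_induct) (auto simp: rep_const rep_add)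
  have "rep f" if "f \<in> HA" for f
    using that
  proof (induction rule: fun_algebra.induct)
    case (const c)
    show ?case
      by (rule rep_cong[OF rep_const[of c]]) simp
  next
    case (gen l)
    obtain a where a: "\<And>b. b \<in> Hom M N \<Longrightarrow>
        l b = (\<Sum>i\<in>Basis \<times> {..<n}. a i * representation Basis (q (b (p (\<mu> (snd i))))) (fst i))"
      using functional_matrix_coefficients[OF \<mu> gen] by blast
    have "rep (\<lambda>b. representation Basis (q (b (p (\<mu> k)))) t)" if "k < n" for t k
    proof -
      have "lin_form (\<lambda>v. representation Basis (q v) t)"
        unfolding lin_form_iff
        by (simp add: q_add lin_scale[OF q_lin] representation_add[OF independent_Basis]
            representation_scale[OF independent_Basis] span_Basis)
      then show ?thesis
        using D(3)[of "\<lambda>v. representation Basis (q v) t" k] that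
        unfolding rep_def by (auto simp: representation_zero)
    qed
    then have "rep (\<lambda>b. \<Sum>i\<in>Basis \<times> {..<n}.
        a i * representation Basis (q (b (p (\<mu> (snd i))))) (fst i))"
      by (intro rep_sum rep_mult rep_const) auto
    then show ?case
      by (rule rep_cong) (simp add: a)
  next
    case (add f g)
    show ?case
      by (rule rep_cong[OF rep_add[OF add.IH]]) simp
  next
    case (mult f g)
    show ?case
      by (rule rep_cong[OF rep_mult[OF mult.IH]]) simp
  qed
  then show ?thesis
    using that D(1,2) unfolding rep_def by blast
qed

lemma pluecker_open_slope:
  assumes rigid and \<mu>: "frame scale (dim M) M \<mu>" and W: "W \<in> SM"
    and P: "pluecker_form scale (dim M) d P"
  shows "W \<in> pluecker_open (dim M) P \<longleftrightarrow> P (lift \<mu> (slope W)) \<noteq> 0"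
proof -
  have f: "frame scale (dim M) W (lift \<mu> (slope W))"
    using frame_lift[OF \<mu> slope_Hom[OF assms(1) W]] graph_slope[OF assms(1) W] by simp
  show ?thesis
  proof
    show "W \<in> pluecker_open (dim M) P \<Longrightarrow> P (lift \<mu> (slope W)) \<noteq> 0"
      using pluecker_openD[OF _ P f] .
    show "P (lift \<mu> (slope W)) \<noteq> 0 \<Longrightarrow> W \<in> pluecker_open (dim M) P"
      using f frame_dim[OF f] unfolding pluecker_open_def by blast
  qed
qed

lemma slope_continuous:
  assumes rigid
  shows "continuous_map (zariski SV) (zariski HV) slope"
proof -
  obtain \<mu> where \<mu>: "frame scale (dim M) M \<mu>"
    using frame_exists[OF sub_M] by blast
  have HV: "zariski HV = topology_generated_by {{b \<in> Hom M N. f b \<noteq> 0} | f. f \<in> HA}"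
    unfolding HV_eq affine_fun_space_def by (simp add: Let_def)
  show ?thesis
    unfolding HV
  proof (rule continuous_on_generated_topo)
    fix U assume "U \<in> {{b \<in> Hom M N. f b \<noteq> 0} | f. f \<in> HA}"
    then obtain f where f: "f \<in> HA" and U: "U = {b \<in> Hom M N. f b \<noteq> 0}"
      by blast
    obtain e P where P: "pluecker_form scale (dim M) e P"
      "\<And>b. b \<in> Hom M N \<Longrightarrow> P (lift \<mu> b) = f b"
      using coordinate_pluecker[OF \<mu>] f by metis
    have "slope W \<in> U \<longleftrightarrow> W \<in> pluecker_open (dim M) P" if "W \<in> SM" for W
      using pluecker_open_slope[OF assms \<mu> that P(1)] P(2)[OF slope_Hom[OF assms that]]
        slope_Hom[OF assms that] by (simp add: U)
    then have "slope -` U \<inter> points SV = pluecker_open (dim M) P \<inter> SM"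
      unfolding points_SV by blast
    then show "openin (zariski SV) (slope -` U \<inter> points SV)"
      unfolding zariski_SV openin_subtopology using openin_pluecker_open[OF P(1)] by blast
  next
    have "slope ` points SV \<subseteq> points HV"
      unfolding points_HV points_SV using slope_Hom[OF assms] by blast
    then show "slope ` points SV \<subseteq> \<Union> {{b \<in> Hom M N. f b \<noteq> 0} | f. f \<in> HA}"
      unfolding HV topology_generated_by_topspace .
  qed
qed

lemma slope_morphism:
  assumes rigid
  shows "variety_morphism SV HV slope"
  unfolding variety_morphism_def
proof (intro conjI allI impI ballI)
  show cont: "continuous_map (zariski SV) (zariski HV) slope"
    using slope_continuous[OF assms] .
  obtain \<mu> where \<mu>: "frame scale (dim M) M \<mu>"
    using frame_exists[OF sub_M] by blast
  obtain D where D: "pluecker_form scale (dim M) 1 D" "\<And>b. b \<in> Hom M N \<Longrightarrow> D (lift \<mu> b) = 1"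
    and coord: "\<And>f. f \<in> HA \<Longrightarrow>
      \<exists>e P. pluecker_form scale (dim M) e P \<and> (\<forall>b\<in>Hom M N. P (lift \<mu> b) = f b)"
    using coordinate_pluecker[OF \<mu>] by blast
  fix U h assume U: "openin (zariski HV) U" and h: "h \<in> regular HV U"
  let ?V = "{W \<in> points SV. slope W \<in> U}"
  have "\<exists>U'. openin (zariski grass) U' \<and> W \<in> U' \<and>
      (\<exists>g \<in> regular grass U'. \<forall>Y \<in> ?V \<inter> U'. restrict (h \<circ> slope) ?V Y = g Y)"
    if W: "W \<in> ?V" for W
  proof -
    obtain U1 f g where U1: "openin (zariski HV) U1" "slope W \<in> U1"
      and f: "f \<in> HA" and g: "g \<in> HA" and fg: "\<And>b. b \<in> U1 \<Longrightarrow> g b \<noteq> 0 \<and> h b = f b / g b"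
      using h W unfolding regular_HV by blast
    obtain d P where P: "pluecker_form scale (dim M) d P"
      and Pf: "\<And>b. b \<in> Hom M N \<Longrightarrow> P (lift \<mu> b) = f b"
      using coord[OF f] by blast
    obtain e Q where Q: "pluecker_form scale (dim M) e Q"
      and Qg: "\<And>b. b \<in> Hom M N \<Longrightarrow> Q (lift \<mu> b) = g b"
      using coord[OF g] by blast
    let ?P = "\<lambda>w. P w * D w ^ e" and ?Q = "\<lambda>w. Q w * D w ^ d"
    have P': "pluecker_form scale (dim M) (d + e) ?P"
      using pluecker_form_mult[OF P pluecker_form_power[OF D(1)]] .
    have Q': "pluecker_form scale (dim M) (d + e) ?Q"
      using pluecker_form_mult[OF Q pluecker_form_power[OF D(1), of d]] by (simp add: add.commute)
    have "openin (zariski SV) {Y \<in> points SV. slope Y \<in> U1}"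
      by (rule openin_continuous_map_preimage[OF cont U1(1)])
    then obtain O' where O': "openin (zariski grass) O'" "{Y \<in> points SV. slope Y \<in> U1} = O' \<inter> SM"
      unfolding zariski_SV openin_subtopology by blast
    \<comment> \<open>\<open>O'\<close> traces the required open set on the summands only. Away from
      them the denominator may vanish, so the neighbourhood is cut down to make the quotient regular
      on an open set of the Grassmannian.\<close>
    let ?U' = "O' \<inter> pluecker_open (dim M) ?Q"
    have U': "openin (zariski grass) ?U'"
      using O'(1) openin_pluecker_open[OF Q'] by (rule openin_Int)
    have WS: "W \<in> SM"
      using W points_SV by simp
    have val: "?P (lift \<mu> (slope Y)) = f (slope Y)" "?Q (lift \<mu> (slope Y)) = g (slope Y)"
      if "Y \<in> SM" for Y
      using slope_Hom[OF assms that] by (simp_all add: Pf Qg D(2))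
    have "W \<in> O'"
      using WS U1(2) O'(2) points_SV by blast
    moreover have "W \<in> pluecker_open (dim M) ?Q"
      using pluecker_open_slope[OF assms \<mu> WS Q'] val(2)[OF WS] fg[OF U1(2)] by simp
    ultimately have "W \<in> ?U'"
      by blast
    obtain k where k: "k \<in> regular grass ?U'"
      and kPQ: "\<And>Y w. Y \<in> ?U' \<Longrightarrow> frame scale (dim M) Y w \<Longrightarrow> k Y = ?P w / ?Q w"
      using quotient_regular_on_grassmannian[OF P' Q' U'] by blast
    have "restrict (h \<circ> slope) ?V Y = k Y" if Y: "Y \<in> ?V \<inter> ?U'" for Y
    proof -
      have YS: "Y \<in> SM" and YU1: "slope Y \<in> U1"
        using Y O'(2) points_SV by auto
      have "frame scale (dim M) Y (lift \<mu> (slope Y))"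
        using frame_lift[OF \<mu> slope_Hom[OF assms YS]] graph_slope[OF assms YS] by simp
      then have "k Y = f (slope Y) / g (slope Y)"
        using kPQ Y val[OF YS] by auto
      then show ?thesis
        using fg[OF YU1] Y by simp
    qed
    then show ?thesis
      using U' \<open>W \<in> ?U'\<close> k by blast
  qed
  then show "restrict (h \<circ> slope) ?V \<in> regular SV ?V"
    unfolding regular_SV by simp
qed

lemma summand_variety_isomorphic_Hom:
  assumes rigid
  shows "variety_isomorphic SV HV"
  unfolding variety_isomorphic_def points_SV points_HV
  using slope_morphism[OF assms] graph_morphism graph_slope[OF assms] slope_graph[OF assms] by blast

text \<open>Needed for \<open>product_variety_points\<close>. On the Grassmannian the constant 1 is
  a quotient of two forms of degree 0.\<close>

lemma one_regular_SV: "(\<lambda>W\<in>SM. 1) \<in> regular SV SM"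
proof -
  obtain g where g: "g \<in> regular grass (points grass)"
    "\<And>W w. W \<in> points grass \<Longrightarrow> frame scale (dim M) W w \<Longrightarrow> g W = 1 / 1"
  proof (rule quotient_regular_on_grassmannian[of "dim M" 0 "\<lambda>w. 1" "\<lambda>w. 1" "points grass"])
    show "points grass \<subseteq> pluecker_open (dim M) (\<lambda>w. 1)"
      using frame_exists unfolding grassmannian_points pluecker_open_def by fastforce
  qed (use pluecker_form.const in auto)
  have "g W = 1" if "W \<in> SM" for W
  proof -
    have W: "W \<in> points grass" "subspace W" "dim W = dim M"
      using that summands_dim summand_subspace grassmannian_points by auto
    then show ?thesis
      using g(2)[OF W(1)] frame_exists[OF W(2,3)] by auto
  qed
  moreover have "W \<in> points grass" if "W \<in> SM" for W
    using that summands_dim summand_subspace grassmannian_points by auto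
  ultimately show ?thesis
    unfolding regular_SV using g(1)
    by (auto intro!: exI[of _ "points grass"] bexI[of _ g])
qed

end

text \<open>The points are by definition the union of the generating open sets. The tensor product
  of the two constant functions 1 vanishes nowhere, so the full product is one of these
  sets.\<close>

lemma product_variety_points:
  fixes X :: "('a, 'k::field) fun_space" and Y :: "('b, 'k) fun_space"
  assumes "(\<lambda>x\<in>points X. 1) \<in> regular X (points X)"
    and "(\<lambda>y\<in>points Y. 1) \<in> regular Y (points Y)"
  shows "points (product_variety X Y) = points X \<times> points Y"
proof -
  let ?B = "{{z \<in> U \<times> V. t z \<noteq> 0} | U V t. openin (zariski X) U \<and> openin (zariski Y) V \<and>
      t \<in> product_functions X Y U V}"
  have "points (product_variety X Y) = \<Union> ?B"
    unfolding product_variety_def by (simp add: Let_def)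
  also have "\<dots> = points X \<times> points Y"
  proof
    show "\<Union> ?B \<subseteq> points X \<times> points Y"
      using openin_subset[of "zariski X"] openin_subset[of "zariski Y"] by blast
    let ?t = "\<lambda>(x, y). \<Sum>i<1::nat. (\<lambda>x\<in>points X. 1 :: 'k) x * (\<lambda>y\<in>points Y. 1 :: 'k) y"
    have "?t \<in> product_functions X Y (points X) (points Y)"
      unfolding product_functions_def
      by (intro CollectI exI[of _ "1::nat"] exI[of _ "\<lambda>i. \<lambda>x\<in>points X. 1"]
          exI[of _ "\<lambda>i. \<lambda>y\<in>points Y. 1"] conjI refl) (use assms in simp)
    then have "{z \<in> points X \<times> points Y. ?t z \<noteq> 0} \<in> ?B"
      by (intro CollectI exI[of _ "points X"] exI[of _ "points Y"] exI[of _ ?t] conjI refl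
          openin_topspace)
    moreover have "{z \<in> points X \<times> points Y. ?t z \<noteq> 0} = points X \<times> points Y"
      by auto
    ultimately show "points X \<times> points Y \<subseteq> \<Union> ?B"
      by (metis (no_types, lifting) Union_upper)
  qed
  finally show ?thesis .
qed

theorem theorem3p3p2:
  fixes G :: "('g, 'k::alg_closed_field) alg_group"
    and r :: nat
    and scale :: "'k \<Rightarrow> 'v::ab_group_add \<Rightarrow> 'v"
    and Basis :: "'v set"
    and \<rho> :: "'g \<Rightarrow> 'v \<Rightarrow> 'v"
    and M N :: "'v set"
  assumes "CHAR('k) > 0"
    and "simple_algebraic_group G" and "simply_connected_group G"
    and "r \<ge> 1"
    and "finite_dimensional_vector_space scale Basis"
    and "rational_module G scale \<rho>"
    and "Gr_complement G r scale \<rho> M N"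
  shows
    "let XM = summands G r scale \<rho> M;
         XN = summands G r scale \<rho> N;
         Hom = Gr_hom G r scale \<rho>;
         Aut = Gr_aut G r scale \<rho>;
         C1 = (\<forall>M' \<in> XM. Gr_complement G r scale \<rho> M' N);
         C2 = (\<forall>N' \<in> XN. Gr_complement G r scale \<rho> N' M);
         C3 = (\<forall>M' \<in> XM. \<forall>N' \<in> XN. Gr_complement G r scale \<rho> M' N');
         C4 = bij_betw (blocks M N) (Aut UNIV) (Aut M \<times> Hom M N \<times> Hom N M \<times> Aut N);
         C5 = (\<forall>b \<in> Hom M N. \<forall>c \<in> Hom N M. nilpotent_map (off_diagonal M N b c))
     in (C1 \<longleftrightarrow> C2) \<and> (C1 \<longleftrightarrow> C3) \<and> (C1 \<longleftrightarrow> C4) \<and> (C1 \<longleftrightarrow> C5) \<and>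
        (C1 \<or> C2 \<or> C3 \<or> C4 \<or> C5 \<longrightarrow>
           variety_isomorphic (summand_variety G r scale \<rho> M) (Hom_variety G r scale \<rho> M N) \<and>
           variety_isomorphic (summand_variety G r scale \<rho> N) (Hom_variety G r scale \<rho> N M) \<and>
           decompositions G r scale \<rho> M N =
             points (product_variety (summand_variety G r scale \<rho> M)
                                     (summand_variety G r scale \<rho> N)))"
proof -
  interpret finite_dimensional_vector_space scale Basis
    by fact
  interpret m: Gr_decomposition scale Basis G r \<rho> M N
    by unfold_locales fact+
  interpret n: Gr_decomposition scale Basis G r \<rho> N M
    by (rule m.swap)
  let ?XM = "summands G r scale \<rho> M" and ?XN = "summands G r scale \<rho> N"
  have rigid: "m.rigid \<longleftrightarrow> n.rigid"
    using m.rigid_swap n.rigid_swap by blast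
  \<comment> \<open>Taking \<open>N' = N\<close> in the third condition gives the first.\<close>
  have self: "M \<in> ?XM" "N \<in> ?XN"
    using m.image_in_summands[OF m.Endo_id] n.image_in_summands[OF m.Endo_id] by simp_all
  have 1: "(\<forall>M' \<in> ?XM. Gr_complement G r scale \<rho> M' N) \<longleftrightarrow> m.rigid"
    using m.complements_imp_rigid m.rigid_imp_complements by blast
  have 2: "(\<forall>N' \<in> ?XN. Gr_complement G r scale \<rho> N' M) \<longleftrightarrow> m.rigid"
    using n.complements_imp_rigid n.rigid_imp_complements rigid by blast
  have 3: "(\<forall>M' \<in> ?XM. \<forall>N' \<in> ?XN. Gr_complement G r scale \<rho> M' N') \<longleftrightarrow> m.rigid"
    using 1 self m.rigid_imp_all_complements by blast
  have 4: "bij_betw (blocks M N) (Gr_aut G r scale \<rho> UNIV) (Gr_aut G r scale \<rho> M \<times>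
      Gr_hom G r scale \<rho> M N \<times> Gr_hom G r scale \<rho> N M \<times> Gr_aut G r scale \<rho> N) \<longleftrightarrow> m.rigid"
    using m.blocks_bij_imp_rigid m.rigid_imp_blocks_bij by blast
  have 5: "(\<forall>b \<in> Gr_hom G r scale \<rho> M N. \<forall>c \<in> Gr_hom G r scale \<rho> N M.
      nilpotent_map (off_diagonal M N b c)) \<longleftrightarrow> m.rigid"
    using m.nilpotent_imp_rigid m.rigid_imp_nilpotent by blast
  have "points (product_variety (summand_variety G r scale \<rho> M) (summand_variety G r scale \<rho> N))
      = ?XM \<times> ?XN"
    using product_variety_points[of "summand_variety G r scale \<rho> M" "summand_variety G r scale \<rho> N"]
      m.one_regular_SV n.one_regular_SV by (simp add: m.points_SV n.points_SV)
  \<comment> \<open>Rigidity supplies the inclusion of the full product: summands of the two types,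
    chosen independently, are always complementary.\<close>
  moreover have "decompositions G r scale \<rho> M N = ?XM \<times> ?XN" if m.rigid
  proof
    show "decompositions G r scale \<rho> M N \<subseteq> ?XM \<times> ?XN"
      unfolding decompositions_def summands_def using Gr_complement_commute by blast
    show "?XM \<times> ?XN \<subseteq> decompositions G r scale \<rho> M N"
      using m.rigid_imp_all_complements[OF that] unfolding decompositions_def
      by (auto simp: summands_def)
  qed
  ultimately show ?thesis
    unfolding Let_def 1 2 3 4 5
    using m.summand_variety_isomorphic_Hom n.summand_variety_isomorphic_Hom rigid by simp
qed

end
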